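(* Let $k\in\mathbb{N}$ and let $(m_1(n))_n,\dots,(m_k(n))_n$ be sequences of positive integers with $m_j(n)\le\alpha(n)$ for all $n$ and all $j\le k$, and (for all sufficiently large $n$) $m_i(n)\ne m_j(n)$ for $i\neq j$. Assume that for all $j\le k$, $$\limsup_{n\to\infty}\mu_{m_j(n)}(n)<\infty .$$ Then, writing $\mu_{m_j}=\mu_{m_j(n)}(n)$ and $m_j=m_j(n)$, as $n\to\infty$, $$\Big(C_{m_1}^{(\mu_{m_1})},\dots,C_{m_k}^{(\mu_{m_k})}\Big)\stackrel{d}{\longrightarrow}(Z_1,\dots,Z_k),$$ where $Z_1,\dots,Z_k$ are independent Poisson distributed random variables with parameter $1$.
   Context: Fix $a_1,a_2\in(0,1)$ and a sequence $\alpha=(\alpha(n))_{n\in\mathbb{N}}$ with $n^{a_1}\le\alpha(n)\le n^{a_2}$. Sums $\sum_{j=1}^{\alpha(n)}$ run over the integers $j$ with $1\le j\le\alpha(n)$. $S_{n,\alpha}$ is the set of permutations of $\{1,\dots,n\}$ all of whose cycles have length at most $\alpha(n)$; $\mathbb{P}_{n,\alpha}$ is the uniform probability measure on $S_{n,\alpha}$. $C_m=C_m(\sigma)$ is the number of cycles of length $m$ in $\sigma$. $x_{n,\alpha}$ is the unique positive solution of $n=\sum_{j=1}^{\alpha(n)}x_{n,\alpha}^{j}$, and $\mu_m(n):=x_{n,\alpha}^m/m$. Tilted cycle numbers: for $\nu_1,\dots,\nu_k>0$, the random vector $(C_{m_1}^{(\nu_1)},\dots,C_{m_k}^{(\nu_k)})$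 (for given $n$) has by definition the distribution $$\mathbb{P}\big[C_{m_1}^{(\nu_1)}=l_1,\dots,C_{m_k}^{(\nu_k)}=l_k\big]=\frac1Z\Big(\prod_{j=1}^k\frac{e^{\nu_j}}{\nu_j^{l_j}}\Big)\mathbb{P}_{n,\alpha}\big[C_{m_1}=l_1,\dots,C_{m_k}=l_k\big],\qquad l_1,\dots,l_k\in\mathbb{N}_0,$$ where $Z$ (depending on $n$) is the normalizing constant. *)

theory Defs
  imports "HOL-Probability.Probability" "HOL-Combinatorics.Orbits"
begin

section \<open>Permutations with cycle lengths bounded by a given value\<close>

definition cycles_of :: "nat \<Rightarrow> (nat \<Rightarrow> nat) \<Rightarrow> nat set set" where
  "cycles_of n \<sigma> = orbit \<sigma> ` {1..n}"

definition cycle_count :: "nat \<Rightarrow> nat \<Rightarrow> (nat \<Rightarrow> nat) \<Rightarrow> nat" where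
  "cycle_count n m \<sigma> = card {c \<in> cycles_of n \<sigma>. card c = m}"

definition bounded_cycle_perms :: "(nat \<Rightarrow> real) \<Rightarrow> nat \<Rightarrow> (nat \<Rightarrow> nat) set" where
  "bounded_cycle_perms \<alpha> n =
     {\<sigma>. \<sigma> permutes {1..n} \<and> (\<forall>c\<in>cycles_of n \<sigma>. real (card c) \<le> \<alpha> n)}"

definition uniform_perm :: "(nat \<Rightarrow> real) \<Rightarrow> nat \<Rightarrow> (nat \<Rightarrow> nat) pmf" where
  "uniform_perm \<alpha> n = pmf_of_set (bounded_cycle_perms \<alpha> n)"

definition saddle_point :: "(nat \<Rightarrow> real) \<Rightarrow> nat \<Rightarrow> real" where
  "saddle_point \<alpha> n = (THE x. 0 < x \<and> real n = (\<Sum>j | 1 \<le> j \<and> real j \<le> \<alpha> n. x ^ j))"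

definition cycle_mean :: "(nat \<Rightarrow> real) \<Rightarrow> nat \<Rightarrow> nat \<Rightarrow> real" where
  "cycle_mean \<alpha> n m = saddle_point \<alpha> n ^ m / real m"


section \<open>Tilted cycle numbers\<close>

definition cycle_count_pmf ::
    "(nat \<Rightarrow> real) \<Rightarrow> nat \<Rightarrow> ('k \<Rightarrow> nat) \<Rightarrow> ('k \<Rightarrow> nat) pmf" where
  "cycle_count_pmf \<alpha> n m = map_pmf (\<lambda>\<sigma> j. cycle_count n (m j) \<sigma>) (uniform_perm \<alpha> n)"

definition tilt_weight :: "('k::finite \<Rightarrow> real) \<Rightarrow> ('k \<Rightarrow> nat) pmf \<Rightarrow> ('k \<Rightarrow> nat) \<Rightarrow> real" where
  "tilt_weight \<nu> p l = (\<Prod>j\<in>UNIV. exp (\<nu> j) / \<nu> j ^ l j) * pmf p l"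

definition tilt_pmf :: "('k::finite \<Rightarrow> real) \<Rightarrow> ('k \<Rightarrow> nat) pmf \<Rightarrow> ('k \<Rightarrow> nat) pmf" where
  "tilt_pmf \<nu> p =
     embed_pmf (\<lambda>l. tilt_weight \<nu> p l / (\<Sum>\<^sub>\<infinity>l'. tilt_weight \<nu> p l'))"

definition tilted_cycle_count_pmf ::
    "(nat \<Rightarrow> real) \<Rightarrow> nat \<Rightarrow> ('k::finite \<Rightarrow> real) \<Rightarrow> ('k \<Rightarrow> nat) \<Rightarrow> ('k \<Rightarrow> nat) pmf" where
  "tilted_cycle_count_pmf \<alpha> n \<nu> m = tilt_pmf \<nu> (cycle_count_pmf \<alpha> n m)"


section \<open>Convergence in distribution of random vectors\<close>

text \<open>
  The library's \<open>weak_conv_m\<close> only covers real-valued random variables, so convergence of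
  laws is defined by testing against bounded continuous functions.
\<close>

definition conv_in_distribution ::
    "(nat \<Rightarrow> 'a::topological_space measure) \<Rightarrow> 'a measure \<Rightarrow> bool" where
  "conv_in_distribution M N \<longleftrightarrow>
     (\<forall>f::'a \<Rightarrow> real. continuous_on UNIV f \<longrightarrow> bounded (range f) \<longrightarrow>
        (\<lambda>n. \<integral>x. f x \<partial>M n) \<longlonglongrightarrow> (\<integral>x. f x \<partial>N))"

definition vector_law :: "('k::finite \<Rightarrow> nat) pmf \<Rightarrow> (real ^ 'k) measure" where
  "vector_law p = distr (measure_pmf p) borel (\<lambda>l. \<chi> j. real (l j))"

text \<open>Joint law of independent Poisson variables with parameter 1.\<close>

definition indep_poisson_one :: "('k::finite \<Rightarrow> nat) pmf" where
  "indep_poisson_one = Pi_pmf UNIV 0 (\<lambda>_. poisson_pmf 1)"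


section \<open>Well-definedness\<close>

lemma finite_bounded_cycle_perms: "finite (bounded_cycle_perms \<alpha> n)"
  by (rule finite_subset[OF _ finite_permutations[of "{1..n}"]])
     (auto simp: bounded_cycle_perms_def)

lemma orbit_id: "orbit id x = {x}"
proof -
  have "y = x" if "y \<in> orbit id x" for y
    using that by induction auto
  then show ?thesis using orbit.base[of id x] by auto
qed

lemma bounded_cycle_perms_nonempty:
  assumes "1 \<le> \<alpha> n"
  shows "bounded_cycle_perms \<alpha> n \<noteq> {}"
proof -
  have "id \<in> bounded_cycle_perms \<alpha> n"
    using assms by (auto simp: bounded_cycle_perms_def cycles_of_def orbit_id permutes_id)
  then show ?thesis by blast
qed

lemma finite_set_cycle_count_pmf:
  assumes "1 \<le> \<alpha> n"
  shows "finite (set_pmf (cycle_count_pmf \<alpha> n m))"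
  using finite_bounded_cycle_perms[of \<alpha> n] bounded_cycle_perms_nonempty[of \<alpha> n, OF assms]
  by (simp add: cycle_count_pmf_def uniform_perm_def)

lemma pmf_tilt_pmf:
  fixes \<nu> :: "'k::finite \<Rightarrow> real"
  assumes \<nu>: "\<And>j. 0 < \<nu> j" and fin: "finite (set_pmf p)"
  shows "pmf (tilt_pmf \<nu> p) l = tilt_weight \<nu> p l / (\<Sum>\<^sub>\<infinity>l'. tilt_weight \<nu> p l')"
proof -
  let ?w = "tilt_weight \<nu> p" and ?S = "set_pmf p"
  define Z where "Z = (\<Sum>\<^sub>\<infinity>l'. ?w l')"
  have w0: "?w l = 0" if "l \<notin> ?S" for l
    using that by (simp add: tilt_weight_def set_pmf_iff)
  have wpos: "?w l > 0" if "l \<in> ?S" for l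
    unfolding tilt_weight_def
    by (intro mult_pos_pos prod_pos pmf_positive that ballI divide_pos_pos zero_less_power \<nu> exp_gt_zero)
  have wnn: "?w l \<ge> 0" for l
    using w0[of l] wpos[of l] by (cases "l \<in> ?S") auto
  have Z: "Z = (\<Sum>l\<in>?S. ?w l)"
    unfolding Z_def using infsum_cong_neutral[of ?S UNIV ?w ?w] w0 fin by auto
  have Zpos: "Z > 0"
    unfolding Z by (rule sum_pos[OF fin set_pmf_not_empty wpos])
  have "(\<integral>\<^sup>+l. ennreal (?w l / Z) \<partial>count_space UNIV) = (\<Sum>l\<in>?S. ennreal (?w l / Z))"
    by (rule nn_integral_count_space'[OF fin]) (auto simp: w0)
  also have "\<dots> = ennreal (\<Sum>l\<in>?S. ?w l / Z)"
    using wnn Zpos by (intro sum_ennreal) (auto intro: divide_nonneg_pos)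
  also have "(\<Sum>l\<in>?S. ?w l / Z) = 1"
    using Zpos by (simp add: sum_divide_distrib[symmetric] Z[symmetric])
  finally have one: "(\<integral>\<^sup>+l. ennreal (?w l / Z) \<partial>count_space UNIV) = 1" by simp
  have "pmf (embed_pmf (\<lambda>l. ?w l / Z)) l = ?w l / Z"
    by (rule pmf_embed_pmf) (use wnn Zpos one in \<open>auto intro: divide_nonneg_pos\<close>)
  then show ?thesis by (simp add: tilt_pmf_def Z_def)
qed

lemma finite_real_bounded_nats: "finite {j::nat. 1 \<le> j \<and> real j \<le> a}"
proof (rule finite_subset)
  show "{j::nat. 1 \<le> j \<and> real j \<le> a} \<subseteq> {..nat \<lfloor>a\<rfloor>}"
    by (auto simp: le_nat_floor)
qed simp

lemma saddle_point_ex1: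
  assumes "1 \<le> n" and "1 \<le> \<alpha> n"
  shows "\<exists>!x. 0 < x \<and> real n = (\<Sum>j | 1 \<le> j \<and> real j \<le> \<alpha> n. x ^ j)"
proof -
  define J where "J = {j::nat. 1 \<le> j \<and> real j \<le> \<alpha> n}"
  define f where "f x = (\<Sum>j\<in>J. x ^ j)" for x :: real
  have J: "finite J" "1 \<in> J" "\<And>j. j \<in> J \<Longrightarrow> 1 \<le> j"
    using finite_real_bounded_nats assms by (auto simp: J_def)
  have f0: "f 0 = 0"
    unfolding f_def by (intro sum.neutral) (use J(3) in \<open>fastforce simp: power_0_left\<close>)
  have "real n ^ 1 \<le> f (real n)"
    unfolding f_def by (rule member_le_sum) (use J in auto)
  then have fn: "real n \<le> f (real n)" by simp
  have "continuous_on {0..real n} f"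
    unfolding f_def by (intro continuous_intros)
  then obtain x where x: "0 \<le> x" "f x = real n"
    using IVT'[of f 0 "real n" "real n"] f0 fn by auto
  have "x \<noteq> 0" using x f0 assms by auto
  then have xpos: "0 < x" using x by simp
  have mono: "f y < f z" if "0 < y" "y < z" for y z
    unfolding f_def
  proof (rule sum_strict_mono)
    show "y ^ j < z ^ j" if "j \<in> J" for j
      using J(3)[OF that] \<open>0 < y\<close> \<open>y < z\<close> by (intro power_strict_mono) auto
  qed (use J in auto)
  have "\<exists>!x. 0 < x \<and> real n = f x"
  proof (rule ex1I[of _ x])
    show "y = x" if "0 < y \<and> real n = f y" for y
      using that mono[of x y] mono[of y x] x xpos by (cases x y rule: linorder_cases) auto
  qed (use x xpos in auto)
  then show ?thesis by (simp add: f_def J_def)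
qed

end

theory Submission
  imports Defs "HOL-Combinatorics.Cycles"
begin

text \<open>
  Write \<open>b = \<lfloor>\<alpha> n\<rfloor>\<close>, let \<open>x\<close> be the saddle point and \<open>\<mu>\<^sub>j = x ^ m\<^sub>j / m\<^sub>j\<close>. For a set \<open>Q\<close> of lengths
  let \<open>q\<^sub>Q N\<close> be the coefficient of \<open>z ^ N\<close> in \<open>exp (\<Sum>j\<in>Q. z ^ j / j)\<close>, which is the proportion of
  permutations of \<open>N\<close> points with all cycle lengths in \<open>Q\<close>, and write \<open>h = q\<^sub>Q\<close> for \<open>Q = {1..b}\<close>.

  Cauchy's formula (\<open>count_perms_eq\<close>) gives the joint law of the counts: with \<open>M = {m\<^sub>1, \<dots>, m\<^sub>k}\<close>,
  \<open>Q = {1..b} - M\<close> and \<open>L = \<Sum>j. m\<^sub>j l\<^sub>j\<close>, the probability of \<open>(l\<^sub>1, \<dots>, l\<^sub>k)\<close> is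
  \<open>(\<Prod>j. 1 / (m\<^sub>j ^ l\<^sub>j l\<^sub>j!)) q\<^sub>Q (n - L) / h n\<close>. The tilt turns \<open>m\<^sub>j ^ l\<^sub>j\<close> into \<open>x ^ (m\<^sub>j l\<^sub>j)\<close>, so
  the tilted weight of \<open>l\<close> is exactly \<open>(\<Prod>j. 1 / l\<^sub>j!) \<phi>\<^sub>n l\<close> with
  \<open>\<phi>\<^sub>n l = exp (\<Sum>j. \<mu>\<^sub>j) q\<^sub>Q (n - L) / (h n x ^ L)\<close> (\<open>tilt_weight_eq\<close>). Hence the tilted law has density
  proportional to \<open>\<phi>\<^sub>n\<close> with respect to the product of Poisson laws, and by dominated convergence
  (\<open>integral_tilt_tendsto\<close>) it suffices that \<open>\<phi>\<^sub>n\<close> is bounded uniformly in \<open>l\<close> and \<open>n\<close> and tends to 1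
  pointwise. This takes a ratio estimate for \<open>h\<close> and an inclusion-exclusion argument.

  The first part is \<open>h (n - L) / h n \<approx> x ^ L\<close> for \<open>L = O(b)\<close>. The reason is that \<open>h\<close> is
  log-concave (\<open>coeff_ratio_le_Suc\<close>), that is, \<open>r N = h (N - 1) / h N\<close> is nondecreasing.
  Expanding each \<open>h (N - j)\<close> in the recursion \<open>N h N = \<Sum>j=1..b. h (N - j)\<close> as a product of \<open>j\<close> ratios
  then traps \<open>r\<close> between saddle points: if \<open>x\<^sub>N\<close> denotes the solution of \<open>\<Sum>j=1..b. x\<^sub>N ^ j = N\<close>, then
  \<open>x\<^sub>N \<le> r N \<le> x\<^sub>M\<close> for \<open>N \<ge> b\<close> and \<open>M = N + b - 1\<close>. As \<open>x\<^sub>N ^ b\<close> grows only polynomially in \<open>N\<close>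
  (\<open>saddle_growth\<close>), all ratios that occur between \<open>n - L\<close> and \<open>n\<close> agree with \<open>x = x\<^sub>n\<close> up to a factor whose
  \<open>L\<close>-th power tends to 1, since \<open>b / n\<close> tends to 0 (\<open>bounded_coeff_shift_upper\<close>,
  \<open>bounded_coeff_shift_lower\<close>).

  The second part replaces \<open>h\<close> by \<open>q\<^sub>Q\<close> in the numerator. Deleting one length \<open>m\<close> multiplies the
  generating function by \<open>exp (- z ^ m / m)\<close>; its coefficients, normalised by powers of \<open>x\<close>, are
  \<open>(- \<mu>) ^ k / k!\<close> with \<open>\<mu> = x ^ m / m\<close>, so for bounded \<open>\<mu>\<close> Tannery's theorem shows that each
  deletion contributes a factor \<open>exp (- \<mu>)\<close> in the limit (\<open>norm_coeff_remove_tendsto\<close>).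
\<close>

unbundle no vec_syntax
unbundle fps_syntax

section \<open>Removing one cycle from a permutation\<close>

text \<open>
  The ground set is a parameter because the recursion below passes from \<open>A\<close> to the complement of
  a cycle.
\<close>

definition cycle_number :: "'a set \<Rightarrow> nat \<Rightarrow> ('a \<Rightarrow> 'a) \<Rightarrow> nat" where
  "cycle_number A k \<sigma> = card {c \<in> orbit \<sigma> ` A. card c = k}"

lemma cycle_fun_nth:
  assumes "distinct cs" "i < length cs"
  shows "cycle_of_list cs (cs ! i) = cs ! (Suc i mod length cs)"
proof -
  have "map (cycle_of_list cs) cs = rotate 1 cs"
    using cyclic_rotation[OF assms(1), of 1] by simp
  then have "map (cycle_of_list cs) cs ! i = rotate 1 cs ! i" by simp
  then show ?thesis using assms(2) by (simp add: nth_rotate1)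
qed

text \<open>
  As \<open>support\<close> lists the cycle of a permutation through a point, this recovers the list from the
  glued permutation; it is the reason why gluing is injective.
\<close>

lemma support_glue:
  assumes cs: "distinct (a # xs)" and \<tau>: "\<tau> permutes B" "B \<inter> set (a # xs) = {}"
  shows "support (cycle_of_list (a # xs) \<circ> \<tau>) a = a # xs"
proof -
  let ?cs = "a # xs"
  define \<sigma> where "\<sigma> = cycle_of_list ?cs \<circ> \<tau>"
  have step: "\<sigma> (?cs ! i) = ?cs ! (Suc i mod length ?cs)" if "i < length ?cs" for i
  proof -
    have "?cs ! i \<in> set ?cs" using that by (rule nth_mem)
    then have "\<tau> (?cs ! i) = ?cs ! i" using \<tau> by (intro permutes_not_in[OF \<tau>(1)]) blast
    then show ?thesis using cycle_fun_nth[OF cs that] by (simp add: \<sigma>_def)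
  qed
  have pow: "(\<sigma> ^^ i) a = ?cs ! i" if "i < length ?cs" for i
    using that
  proof (induction i)
    case (Suc i)
    then show ?case using step[of i] by simp
  qed simp
  have last: "(\<sigma> ^^ length ?cs) a = a"
    using pow[of "length xs"] step[of "length xs"] by simp
  have "least_power \<sigma> a = length ?cs"
    unfolding least_power_def
  proof (rule Least_equality)
    show "(\<sigma> ^^ length ?cs) a = a \<and> length ?cs > 0" using last by simp
    fix i assume i: "(\<sigma> ^^ i) a = a \<and> i > 0"
    show "length ?cs \<le> i"
    proof (rule ccontr)
      assume "\<not> length ?cs \<le> i"
      then have "?cs ! i = ?cs ! 0" "i < length ?cs" using i pow[of i] by auto
      then show False using cs i nth_eq_iff_index_eq[OF cs, of i 0] by simp
    qed
  qed
  then have "support \<sigma> a = map (\<lambda>i. ?cs ! i) [0..<length ?cs]"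
    using pow by (simp del: upt_Suc)
  then show ?thesis by (simp only: map_nth \<sigma>_def)
qed

lemma orbits_glue:
  assumes fin: "finite A" and a: "a \<in> A" and xs: "distinct xs" "set xs \<subseteq> A - {a}"
    and \<tau>: "\<tau> permutes (A - set (a # xs))"
  shows "orbit (cycle_of_list (a # xs) \<circ> \<tau>) ` A
           = insert (set (a # xs)) (orbit \<tau> ` (A - set (a # xs)))"
proof -
  let ?cs = "a # xs"
  define \<sigma> where "\<sigma> = cycle_of_list ?cs \<circ> \<tau>"
  have cs: "distinct ?cs" "set ?cs \<subseteq> A" using a xs by auto
  have \<sigma>: "\<sigma> permutes A"
    unfolding \<sigma>_def
    by (rule permutes_compose[OF permutes_subset[OF \<tau>] permutes_subset[OF cycle_permutes cs(2)]]) auto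
  have perm: "permutation \<sigma>" using \<sigma> fin by (auto simp: permutation_permutes)
  have "set (support \<sigma> a) = set ?cs"
    using arg_cong[OF support_glue[OF cs(1) \<tau>], of set] unfolding \<sigma>_def by blast
  then have orb_a: "orbit \<sigma> a = set ?cs"
    using support_set[OF perm, of a] orbit_altdef_permutation[OF perm, of a] by auto
  have 1: "orbit \<sigma> x = set ?cs" if "x \<in> set ?cs" for x
    using orbit_cyclic_eq3[OF cyclic_on_orbit'[OF perm, of a], of x] that orb_a by simp
  have 2: "orbit \<sigma> x = orbit \<tau> x" if x: "x \<in> A - set ?cs" for x
  proof (rule sym, rule orbit_cong0[OF x])
    show "\<tau> \<in> A - set ?cs \<rightarrow> A - set ?cs" using permutes_in_image[OF \<tau>] by auto
    fix y assume "y \<in> A - set ?cs"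
    then have "\<tau> y \<notin> set ?cs" using permutes_in_image[OF \<tau>, of y] by blast
    then show "\<tau> y = \<sigma> y" by (simp add: \<sigma>_def id_outside_supp)
  qed
  have "orbit \<sigma> ` A = orbit \<sigma> ` set ?cs \<union> orbit \<sigma> ` (A - set ?cs)" using cs(2) by blast
  moreover have "orbit \<sigma> ` set ?cs = {set ?cs}" using 1 by (auto simp: image_iff)
  moreover have "orbit \<sigma> ` (A - set ?cs) = orbit \<tau> ` (A - set ?cs)"
    using 2 by (rule image_cong[OF refl])
  ultimately show ?thesis unfolding \<sigma>_def[symmetric] by (metis Un_insert_left sup_bot_left)
qed

lemma cycle_number_glue:
  assumes fin: "finite A" and a: "a \<in> A" and xs: "distinct xs" "set xs \<subseteq> A - {a}"
    and \<tau>: "\<tau> permutes (A - set (a # xs))"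
  shows "cycle_number A k (cycle_of_list (a # xs) \<circ> \<tau>)
           = (if k = Suc (length xs) then 1 else 0) + cycle_number (A - set (a # xs)) k \<tau>"
proof -
  let ?B = "A - set (a # xs)"
  have "set (a # xs) \<notin> orbit \<tau> ` ?B"
    using permutes_orbit_subset[OF \<tau>] by fastforce
  then have new: "set (a # xs) \<notin> {c \<in> orbit \<tau> ` ?B. card c = k}" by simp
  have card: "card (set (a # xs)) = Suc (length xs)"
    using xs by (subst distinct_card) auto
  have "{c \<in> orbit (cycle_of_list (a # xs) \<circ> \<tau>) ` A. card c = k}
      = (if k = Suc (length xs) then insert (set (a # xs)) {c \<in> orbit \<tau> ` ?B. card c = k}
         else {c \<in> orbit \<tau> ` ?B. card c = k})"
    using orbits_glue[OF assms] card by auto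
  then show ?thesis
    using new finite_subset[OF _ finite_imageI[OF finite_Diff[OF fin]], of "{c \<in> orbit \<tau> ` ?B. card c = k}" "orbit \<tau>" "set (a # xs)"]
    by (auto simp: cycle_number_def simp del: list.set)
qed

text \<open>
  A permutation of \<open>A\<close> is determined by the cycle through a chosen point \<open>a\<close>, written as the list
  \<open>a # xs\<close> of successive images of \<open>a\<close>, and by its restriction to the rest. Starting the list
  at \<open>a\<close> makes this bijective, and lists of distinct elements are easy to count.
\<close>

lemma bij_betw_glue:
  assumes fin: "finite A" and a: "a \<in> A"
  shows "bij_betw (\<lambda>(xs, \<tau>). cycle_of_list (a # xs) \<circ> \<tau>)
           (SIGMA xs:{xs. distinct xs \<and> set xs \<subseteq> A - {a}}. {\<tau>. \<tau> permutes (A - set (a # xs))})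
           {\<sigma>. \<sigma> permutes A}"
proof (rule bij_betw_byWitness
    [where f' = "\<lambda>\<sigma>. (tl (support \<sigma> a), perm_restrict \<sigma> (A - orbit \<sigma> a))"])
  let ?D = "SIGMA xs:{xs. distinct xs \<and> set xs \<subseteq> A - {a}}. {\<tau>. \<tau> permutes (A - set (a # xs))}"
  let ?f = "\<lambda>(xs, \<tau>). cycle_of_list (a # xs) \<circ> \<tau>"
  let ?g = "\<lambda>\<sigma>. (tl (support \<sigma> a), perm_restrict \<sigma> (A - orbit \<sigma> a))"
  have perm: "permutation \<sigma>" if "\<sigma> permutes A" for \<sigma>
    using that fin by (auto simp: permutation_permutes)
  have orb: "set (support \<sigma> a) = orbit \<sigma> a" if "\<sigma> permutes A" for \<sigma>
    using support_set[OF perm[OF that], of a] orbit_altdef_permutation[OF perm[OF that], of a]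
    by auto
  have sup: "support \<sigma> a = a # tl (support \<sigma> a)" if "\<sigma> permutes A" for \<sigma>
    using least_power_of_permutation(2)[OF perm[OF that], of a]
    by (subst upt_conv_Cons) (auto simp: upt_conv_Cons)
  have glue: "cycle_of_list (a # xs) \<circ> \<tau> permutes A"
    if "distinct xs" "set xs \<subseteq> A - {a}" "\<tau> permutes (A - set (a # xs))" for xs \<tau>
    by (rule permutes_compose[OF permutes_subset[OF that(3)] permutes_subset[OF cycle_permutes]])
       (use that a in auto)
  show "?f ` ?D \<subseteq> {\<sigma>. \<sigma> permutes A}" using glue by auto
  show "\<forall>p\<in>?D. ?g (?f p) = p"
  proof
    fix p assume "p \<in> ?D"
    then obtain xs \<tau> where p: "p = (xs, \<tau>)" and xs: "distinct xs" "set xs \<subseteq> A - {a}"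
      and \<tau>: "\<tau> permutes (A - set (a # xs))" by blast
    let ?\<sigma> = "cycle_of_list (a # xs) \<circ> \<tau>"
    have s: "support ?\<sigma> a = a # xs" using xs by (intro support_glue[OF _ \<tau>]) auto
    then have o: "orbit ?\<sigma> a = set (a # xs)" using orb[OF glue[OF xs \<tau>]] by metis
    have "perm_restrict ?\<sigma> (A - set (a # xs)) = \<tau>"
    proof
      fix y
      show "perm_restrict ?\<sigma> (A - set (a # xs)) y = \<tau> y"
      proof (cases "y \<in> A - set (a # xs)")
        case True
        then have "\<tau> y \<notin> set (a # xs)" using permutes_in_image[OF \<tau>, of y] by blast
        then show ?thesis using True by (simp add: perm_restrict_def id_outside_supp)
      next
        case False
        then show ?thesis using permutes_not_in[OF \<tau> False] perm_restrict_simps(2)[OF False] by metis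
      qed
    qed
    then show "?g (?f p) = p"
      using s o by (simp only: p prod.case list.sel)
  qed
  show "?g ` {\<sigma>. \<sigma> permutes A} \<subseteq> ?D"
  proof (rule image_subsetI, unfold mem_Collect_eq)
    fix \<sigma> assume \<sigma>: "\<sigma> permutes A"
    let ?xs = "tl (support \<sigma> a)"
    have s: "a # ?xs = support \<sigma> a" using sup[OF \<sigma>] by simp
    have d: "distinct (a # ?xs)" unfolding s by (rule cycle_of_permutation[OF perm[OF \<sigma>]])
    have o: "set (a # ?xs) = orbit \<sigma> a" unfolding s by (rule orb[OF \<sigma>])
    have "set (a # ?xs) \<subseteq> A" unfolding o by (rule permutes_orbit_subset[OF \<sigma> a])
    moreover have "perm_restrict \<sigma> (A - orbit \<sigma> a) permutes (A - orbit \<sigma> a)"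
      by (rule perm_restrict_diff_cyclic[OF \<sigma> cyclic_on_orbit[OF \<sigma> fin]])
    ultimately show "?g \<sigma> \<in> ?D" using d unfolding o[symmetric] by auto
  qed
  show "\<forall>\<sigma>\<in>{\<sigma>. \<sigma> permutes A}. ?f (?g \<sigma>) = \<sigma>"
  proof (rule ballI, unfold mem_Collect_eq)
    fix \<sigma> assume \<sigma>: "\<sigma> permutes A"
    let ?xs = "tl (support \<sigma> a)"
    have s: "a # ?xs = support \<sigma> a" using sup[OF \<sigma>] by simp
    have "(cycle_of_list (support \<sigma> a) \<circ> perm_restrict \<sigma> (A - orbit \<sigma> a)) y = \<sigma> y" for y
    proof (cases "y \<in> orbit \<sigma> a")
      case True
      then have "y \<in> set (support \<sigma> a)" using orb[OF \<sigma>] by simp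
      then show ?thesis
        using True cycle_restrict[OF perm[OF \<sigma>], of y a] by (simp add: perm_restrict_def)
    next
      case False
      then have "\<sigma> y \<notin> orbit \<sigma> a"
        using cyclic_on_f_in[OF \<sigma> cyclic_on_orbit[OF \<sigma> fin], of y a] by blast
      then have "\<sigma> y \<notin> set (support \<sigma> a)" "y \<notin> set (support \<sigma> a)" using False orb[OF \<sigma>] by blast+
      then show ?thesis
        using False permutes_not_in[OF \<sigma>, of y] 
        by (cases "y \<in> A") (simp_all add: perm_restrict_def id_outside_supp del: set_map)
    qed
    then have "cycle_of_list (support \<sigma> a) \<circ> perm_restrict \<sigma> (A - orbit \<sigma> a) = \<sigma>"
      by (rule ext)
    then show "?f (?g \<sigma>) = \<sigma>" by (simp only: prod.case s)
  qed
qed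

text \<open>
  Lengths in \<open>Q\<close> are free and every other multiplicity is prescribed. Both the number of all
  permutations with cycle lengths at most \<open>b\<close> (take \<open>Q = {1..b}\<close> and \<open>l = 0\<close>) and the number of
  those with given counts of some lengths (remove these lengths from \<open>Q\<close>) have this form.
\<close>

definition count_perms :: "'a set \<Rightarrow> nat set \<Rightarrow> (nat \<Rightarrow> nat) \<Rightarrow> nat" where
  "count_perms A Q l = card {\<sigma>. \<sigma> permutes A \<and> (\<forall>k. k \<notin> Q \<longrightarrow> cycle_number A k \<sigma> = l k)}"

text \<open>
  If the length of the cycle through \<open>a\<close> is free, removing that cycle leaves \<open>l\<close> unchanged; otherwise
  it uses up one of the prescribed cycles of that length.
\<close>

lemma count_perms_rec:
  assumes fin: "finite A" and a: "a \<in> A"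
  shows "count_perms A Q l =
    (\<Sum>xs | distinct xs \<and> set xs \<subseteq> A - {a}.
       let B = A - set (a # xs); k = Suc (length xs) in
       if k \<in> Q then count_perms B Q l
       else if l k = 0 then 0
       else count_perms B Q (l(k := l k - 1)))"
proof -
  let ?P = "{xs. distinct xs \<and> set xs \<subseteq> A - {a}}"
  let ?f = "\<lambda>(xs, \<tau>). cycle_of_list (a # xs) \<circ> \<tau>"
  let ?S = "\<lambda>l B. {\<tau>. \<tau> permutes B \<and> (\<forall>k. k \<notin> Q \<longrightarrow> cycle_number B k \<tau> = l k)}"
  define T where "T xs = {\<tau>. \<tau> permutes (A - set (a # xs)) \<and>
      (\<forall>k. k \<notin> Q \<longrightarrow> (if k = Suc (length xs) then 1 else 0)
                         + cycle_number (A - set (a # xs)) k \<tau> = l k)}" for xs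
  let ?D = "SIGMA xs:?P. {\<tau>. \<tau> permutes (A - set (a # xs))}"
  note bij = bij_betw_glue[OF fin a]
  have finP: "finite ?P"
    by (rule finite_subset[OF _ finite_subset_distinct[of "A - {a}"]]) (use fin in auto)
  have "?S l A = ?f ` Sigma ?P T"
  proof -
    have "?S l A = {\<sigma> \<in> ?f ` ?D. \<forall>k. k \<notin> Q \<longrightarrow> cycle_number A k \<sigma> = l k}"
      using bij_betw_imp_surj_on[OF bij] by auto
    also have "\<dots> = ?f ` {p \<in> ?D. \<forall>k. k \<notin> Q \<longrightarrow> cycle_number A k (?f p) = l k}"
      by blast
    also have "{p \<in> ?D. \<forall>k. k \<notin> Q \<longrightarrow> cycle_number A k (?f p) = l k} = Sigma ?P T"
    proof (rule set_eqI, clarify)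
      fix xs \<tau>
      show "(xs, \<tau>) \<in> {p \<in> ?D. \<forall>k. k \<notin> Q \<longrightarrow> cycle_number A k (?f p) = l k}
          \<longleftrightarrow> (xs, \<tau>) \<in> Sigma ?P T"
        unfolding T_def mem_Collect_eq mem_Sigma_iff prod.case
        by (intro iffI conjI; (elim conjE)?) (simp_all only: cycle_number_glue[OF fin a] simp_thms)
    qed
    finally show ?thesis .
  qed
  moreover have "inj_on ?f (Sigma ?P T)"
    by (rule inj_on_subset[OF bij_betw_imp_inj_on[OF bij]]) (auto simp: T_def)
  ultimately have "count_perms A Q l = card (Sigma ?P T)"
    unfolding count_perms_def by (simp only: card_image)
  also have "\<dots> = (\<Sum>xs\<in>?P. card (T xs))"
  proof (rule card_SigmaI[OF finP], rule ballI)
    show "finite (T xs)" for xs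
      unfolding T_def by (rule finite_subset[OF _ finite_permutations[of "A - set (a # xs)"]])
        (use fin in auto)
  qed
  also have "\<dots> = (\<Sum>xs\<in>?P. let B = A - set (a # xs); k = Suc (length xs) in
       if k \<in> Q then count_perms B Q l
       else if l k = 0 then 0
       else count_perms B Q (l(k := l k - 1)))"
  proof (rule sum.cong[OF refl])
    fix xs
    let ?k = "Suc (length xs)" and ?B = "A - set (a # xs)"
    consider "?k \<in> Q" | "?k \<notin> Q" "l ?k = 0" | "?k \<notin> Q" "l ?k > 0" by auto
    then show "card (T xs) = (let B = ?B; k = ?k in
       if k \<in> Q then count_perms B Q l
       else if l k = 0 then 0
       else count_perms B Q (l(k := l k - 1)))"
    proof cases
      case 1
      then have "T xs = ?S l ?B" unfolding T_def by (intro Collect_cong conj_cong refl all_cong1) auto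
      then show ?thesis using 1 by (simp only: count_perms_def Let_def if_True)
    next
      case 2
      then have "T xs = {}" by (auto simp: T_def)
      then show ?thesis using 2 by simp
    next
      case 3
      then have "T xs = ?S (l(?k := l ?k - 1)) ?B"
        unfolding T_def by (intro Collect_cong conj_cong refl all_cong1) auto
      then show ?thesis using 3 by (simp only: count_perms_def Let_def if_False if_True) simp
    qed
  qed
  finally show ?thesis .
qed

section \<open>Exponential generating functions of permutations with restricted cycle lengths\<close>

text \<open>
  The equation determines the coefficients of positive index recursively, and characteristic 0 allows
  the division by the index. Generating functions below are identified by their equations.
\<close>

lemma fps_ODE_unique:
  fixes F G P :: "'a::field_char_0 fps"
  assumes F: "fps_X * fps_deriv F = P * F" and G: "fps_X * fps_deriv G = P * G"
    and P0: "P $ 0 = 0" and eq0: "F $ 0 = G $ 0"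
  shows "F = G"
proof (rule fps_ext)
  have coeff: "of_nat n * H $ n = (\<Sum>i=1..n. P $ i * H $ (n - i))"
    if "fps_X * fps_deriv H = P * H" "n \<noteq> 0" for H :: "'a fps" and n
  proof -
    have "of_nat n * H $ n = (fps_X * fps_deriv H) $ n"
      using that(2) by (cases n) simp_all
    also have "\<dots> = (\<Sum>i=0..n. P $ i * H $ (n - i))" by (simp only: that(1) fps_mult_nth)
    also have "\<dots> = (\<Sum>i=1..n. P $ i * H $ (n - i))"
      by (simp add: sum.atLeast_Suc_atMost P0)
    finally show ?thesis .
  qed
  fix n show "F $ n = G $ n"
  proof (induction n rule: less_induct)
    case (less n)
    show ?case
    proof (cases "n = 0")
      case False
      have "of_nat n * F $ n = of_nat n * G $ n"
        unfolding coeff[OF F False] coeff[OF G False]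
        by (rule sum.cong[OF refl]) (use less in auto)
      then show ?thesis using False by simp
    qed (simp add: eq0)
  qed
qed

text \<open>
  The exponential formula: the coefficient of \<open>z ^ n\<close> is the number of permutations of \<open>n\<close> points
  with all cycle lengths in \<open>Q\<close>, divided by \<open>n!\<close>.
\<close>

definition cycle_egf :: "nat set \<Rightarrow> real fps" where
  "cycle_egf Q = fps_exp 1 oo Abs_fps (\<lambda>j. if j \<in> Q then 1 / real j else 0)"

lemma cycle_egf_nth_0 [simp]: "cycle_egf Q $ 0 = 1"
  by (simp add: cycle_egf_def)

lemma cycle_egf_ODE:
  "fps_X * fps_deriv (cycle_egf Q)
     = Abs_fps (\<lambda>j. if j \<in> Q \<and> 0 < j then 1 else 0) * cycle_egf Q"
proof -
  let ?P = "Abs_fps (\<lambda>j. if j \<in> Q then 1 / real j else 0)"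
  have "fps_deriv (cycle_egf Q) = cycle_egf Q * fps_deriv ?P"
    unfolding cycle_egf_def by (subst fps_compose_deriv) simp_all
  moreover have "fps_X * fps_deriv ?P = Abs_fps (\<lambda>j. if j \<in> Q \<and> 0 < j then 1 else 0)"
  proof (rule fps_ext)
    show "(fps_X * fps_deriv ?P) $ n = Abs_fps (\<lambda>j. if j \<in> Q \<and> 0 < j then 1 else 0) $ n" for n
      by (cases n) simp_all
  qed
  ultimately show ?thesis
    by (simp only: mult.left_commute[of fps_X "cycle_egf Q"]) (rule mult.commute)
qed

text \<open>
  Combinatorially, \<open>j\<close> is the length of the cycle through a chosen point.
\<close>

lemma cycle_egf_rec:
  "real n * cycle_egf Q $ n = (\<Sum>j | j \<in> Q \<and> 1 \<le> j \<and> j \<le> n. cycle_egf Q $ (n - j))"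
proof -
  have "real n * cycle_egf Q $ n = (fps_X * fps_deriv (cycle_egf Q)) $ n"
    by (cases n) simp_all
  also have "\<dots> = (\<Sum>j=0..n. (if j \<in> Q \<and> 0 < j then 1 else 0) * cycle_egf Q $ (n - j))"
    unfolding cycle_egf_ODE by (simp add: fps_mult_nth)
  also have "\<dots> = (\<Sum>j | j \<in> Q \<and> 1 \<le> j \<and> j \<le> n. cycle_egf Q $ (n - j))"
    by (rule sum.mono_neutral_cong_right) auto
  finally show ?thesis .
qed

lemma cycle_egf_nonneg: "0 \<le> cycle_egf Q $ n"
proof (induction n rule: less_induct)
  case (less n)
  show ?case
  proof (cases "n = 0")
    case False
    have "0 \<le> real n * cycle_egf Q $ n"
      unfolding cycle_egf_rec by (rule sum_nonneg) (use less in auto)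
    then show ?thesis using False by (simp add: zero_le_mult_iff)
  qed simp
qed

lemma cycle_egf_mono:
  assumes "Q \<subseteq> R"
  shows "cycle_egf Q $ n \<le> cycle_egf R $ n"
proof (induction n rule: less_induct)
  case (less n)
  show ?case
  proof (cases "n = 0")
    case False
    have "real n * cycle_egf Q $ n \<le> (\<Sum>j | j \<in> Q \<and> 1 \<le> j \<and> j \<le> n. cycle_egf R $ (n - j))"
      unfolding cycle_egf_rec by (rule sum_mono) (use less in auto)
    also have "\<dots> \<le> real n * cycle_egf R $ n"
      unfolding cycle_egf_rec
      by (rule sum_mono2) (use assms cycle_egf_nonneg in auto)
    finally show ?thesis using False by simp
  qed simp
qed

lemma cycle_egf_remove:
  assumes "m \<in> Q" "0 < m"
  shows "cycle_egf (Q - {m}) = cycle_egf Q * (fps_exp (- 1 / real m) oo fps_X ^ m)"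
proof (rule fps_ODE_unique)
  let ?E = "fps_exp (- 1 / real m) oo fps_X ^ m"
  let ?P = "\<lambda>Q. Abs_fps (\<lambda>j. if j \<in> Q \<and> 0 < j then 1 else 0) :: real fps"
  have X0: "(fps_X ^ m :: real fps) $ 0 = 0" using assms(2) by simp
  show "fps_X * fps_deriv (cycle_egf (Q - {m})) = ?P (Q - {m}) * cycle_egf (Q - {m})"
    by (rule cycle_egf_ODE)
  have "fps_deriv ?E = (fps_const (- 1 / real m) * fps_exp (- 1 / real m) oo fps_X ^ m)
          * fps_deriv (fps_X ^ m)"
    by (subst fps_compose_deriv[OF X0]) simp
  also have "\<dots> = fps_const (- 1 / real m) * ?E * (of_nat m * fps_X ^ (m - 1))"
    by (simp add: fps_compose_mult_distrib[OF X0] fps_deriv_power fps_of_nat)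
  also have "\<dots> = - (?E * fps_X ^ (m - 1))"
  proof -
    have "fps_const (- 1 / real m) * of_nat m = (- 1 :: real fps)"
    proof -
      have "fps_const (- 1 / real m) * of_nat m = fps_const (- 1 / real m * real m)"
        by (simp only: fps_const_mult fps_of_nat[symmetric])
      also have "- 1 / real m * real m = - 1" using assms(2) by simp
      finally show ?thesis by (simp flip: fps_const_neg)
    qed
    then have "fps_const (- 1 / real m) * of_nat m * (?E * fps_X ^ (m - 1)) = - (?E * fps_X ^ (m - 1))"
      by (simp only: mult_minus1)
    then show ?thesis by (simp only: mult.assoc mult.left_commute)
  qed
  finally have E: "fps_X * fps_deriv ?E = - (fps_X ^ m * ?E)"
    using assms(2) by (cases m) (simp_all add: algebra_simps)
  have P: "?P (Q - {m}) = ?P Q - fps_X ^ m"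
    by (rule fps_ext) (use assms in \<open>auto simp: fps_X_power_nth\<close>)
  show "fps_X * fps_deriv (cycle_egf Q * ?E) = ?P (Q - {m}) * (cycle_egf Q * ?E)"
  proof -
    have "fps_X * fps_deriv (cycle_egf Q * ?E)
        = fps_X * fps_deriv (cycle_egf Q) * ?E + cycle_egf Q * (fps_X * fps_deriv ?E)"
      by (simp add: algebra_simps)
    also have "\<dots> = ?P (Q - {m}) * (cycle_egf Q * ?E)"
      unfolding cycle_egf_ODE E P by (simp add: algebra_simps)
    finally show ?thesis .
  qed
qed simp_all

text \<open>
  This is inclusion-exclusion over the cycles of length \<open>m\<close>.
\<close>

lemma cycle_egf_remove_nth:
  assumes "m \<in> Q" "0 < m"
  shows "cycle_egf (Q - {m}) $ n
           = (\<Sum>k | k * m \<le> n. (- 1 / real m) ^ k / fact k * cycle_egf Q $ (n - k * m))"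
proof -
  let ?E = "fps_exp (- 1 / real m) oo fps_X ^ m"
  have E: "?E $ i = (if m dvd i then (- 1 / real m) ^ (i div m) / fact (i div m) else 0)" for i
  proof -
    have "?E $ i = (\<Sum>j=0..i. if i = m * j then (- 1 / real m) ^ j / fact j else 0)"
      unfolding fps_compose_nth power_mult[symmetric] by (rule sum.cong) (auto simp: fps_X_power_nth)
    also have "\<dots> = (\<Sum>j\<in>{0..i}. if j = i div m then (if m dvd i then (- 1 / real m) ^ j / fact j else 0) else 0)"
      by (rule sum.cong) (use assms(2) in auto)
    finally show ?thesis by simp
  qed
  have "cycle_egf (Q - {m}) $ n = (\<Sum>i=0..n. ?E $ i * cycle_egf Q $ (n - i))"
    unfolding cycle_egf_remove[OF assms] by (subst mult.commute) (rule fps_mult_nth)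
  also have "\<dots> = (\<Sum>i\<in>(\<lambda>k. k * m) ` {k. k * m \<le> n}. ?E $ i * cycle_egf Q $ (n - i))"
  proof (rule sum.mono_neutral_right)
    show "\<forall>i\<in>{0..n} - (\<lambda>k. k * m) ` {k. k * m \<le> n}. ?E $ i * cycle_egf Q $ (n - i) = 0"
    proof
      fix i assume i: "i \<in> {0..n} - (\<lambda>k. k * m) ` {k. k * m \<le> n}"
      have "\<not> m dvd i"
      proof
        assume "m dvd i"
        then have "i = i div m * m" by simp
        then show False using i by (metis (no_types, lifting) DiffE atLeastAtMost_iff image_eqI mem_Collect_eq)
      qed
      then show "?E $ i * cycle_egf Q $ (n - i) = 0" by (simp only: E if_False mult_zero_left)
    qed
  qed auto
  also have "\<dots> = (\<Sum>k | k * m \<le> n. ?E $ (k * m) * cycle_egf Q $ (n - k * m))"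
    by (subst sum.reindex) (use assms(2) in \<open>auto simp: inj_on_def\<close>)
  also have "\<dots> = (\<Sum>k | k * m \<le> n. (- 1 / real m) ^ k / fact k * cycle_egf Q $ (n - k * m))"
    by (rule sum.cong[OF refl]) (use assms(2) in \<open>simp only: E, simp\<close>)
  finally show ?thesis .
qed

section \<open>Permutations with prescribed cycle counts\<close>

text \<open>
  The factor in Cauchy's formula: the number of permutations of cycle type \<open>l\<close> (with all lengths in
  \<open>M\<close>) is this number times the factorial of the number of points.
\<close>

definition cauchy_coeff :: "nat set \<Rightarrow> (nat \<Rightarrow> nat) \<Rightarrow> real" where
  "cauchy_coeff M l = (\<Prod>k\<in>M. 1 / (real k ^ l k * fact (l k)))"

lemma cauchy_coeff_decrease:
  assumes "finite M" "j \<in> M" "0 < j" "0 < l j"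
  shows "cauchy_coeff M (l(j := l j - 1)) = real (j * l j) * cauchy_coeff M l"
proof -
  have "cauchy_coeff M (l(j := l j - 1)) = 1 / (real j ^ (l j - 1) * fact (l j - 1))
          * (\<Prod>k\<in>M - {j}. 1 / (real k ^ l k * fact (l k)))"
    unfolding cauchy_coeff_def prod.remove[OF assms(1,2)] by simp
  also have "1 / (real j ^ (l j - 1) * fact (l j - 1))
      = real (j * l j) * (1 / (real j ^ l j * fact (l j)))"
  proof -
    obtain i where "l j = Suc i" using assms(4) gr0_conv_Suc by blast
    then show ?thesis using assms(3) by (simp add: divide_simps distrib_left)
  qed
  finally show ?thesis
    unfolding cauchy_coeff_def prod.remove[OF assms(1,2)] by simp
qed

text \<open>
  The right-hand side of Cauchy's formula satisfies the recursion of \<open>count_perms_rec\<close>. Split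
  \<open>n = (n - L) + L\<close> with \<open>L = \<Sum>k\<in>M. k * l k\<close>: the first part is the recursion of the generating
  function for \<open>Q\<close>, and the term \<open>k * l k\<close> of the second part accounts for the removal of a cycle of
  length \<open>k\<close> by \<open>cauchy_coeff_decrease\<close>.
\<close>

lemma cycle_type_series_rec:
  assumes M: "finite M" "0 \<notin> M" "M \<inter> Q = {}" and n: "0 < n"
    and u: "\<And>l n. u l n = cauchy_coeff M l *
        (if (\<Sum>k\<in>M. k * l k) \<le> n then cycle_egf Q $ (n - (\<Sum>k\<in>M. k * l k)) else 0)"
  shows "real n * u l n = (\<Sum>j=1..n. if j \<in> Q then u l (n - j)
           else if j \<in> M \<and> l j > 0 then u (l(j := l j - 1)) (n - j) else 0)"
proof -
  let ?s = "\<lambda>l. \<Sum>k\<in>M. k * l k" and ?c = "cauchy_coeff M l" and ?F = "cycle_egf Q"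
  define L where "L = ?s l"
  have dec: "?s (l(j := l j - 1)) + j = L" if "j \<in> M" "l j > 0" for j
  proof -
    have "?s (l(j := l j - 1)) = j * (l j - 1) + (\<Sum>k\<in>M - {j}. k * l k)"
      unfolding sum.remove[OF M(1) that(1)] by simp
    moreover have "L = j * l j + (\<Sum>k\<in>M - {j}. k * l k)"
      unfolding L_def sum.remove[OF M(1) that(1)] ..
    moreover have "j * (l j - 1) + j = j * l j" using that(2) by (cases "l j") auto
    ultimately show ?thesis by simp
  qed
  have split: "(\<Sum>j=1..n. if j \<in> Q then u l (n - j)
           else if j \<in> M \<and> l j > 0 then u (l(j := l j - 1)) (n - j) else 0)
      = (\<Sum>j | j \<in> Q \<and> 1 \<le> j \<and> j \<le> n. u l (n - j))
        + (\<Sum>j | j \<in> M \<and> 1 \<le> j \<and> j \<le> n \<and> l j > 0. u (l(j := l j - 1)) (n - j))"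
  proof -
    have "(\<Sum>j=1..n. if j \<in> Q then u l (n - j)
           else if j \<in> M \<and> l j > 0 then u (l(j := l j - 1)) (n - j) else 0)
        = (\<Sum>j=1..n. (if j \<in> Q then u l (n - j) else 0)
            + (if j \<in> M \<and> l j > 0 then u (l(j := l j - 1)) (n - j) else 0))"
      by (rule sum.cong) (use M(3) in auto)
    also have "\<dots> = (\<Sum>j\<in>{1..n} \<inter> {j. j \<in> Q}. u l (n - j))
        + (\<Sum>j\<in>{1..n} \<inter> {j. j \<in> M \<and> l j > 0}. u (l(j := l j - 1)) (n - j))"
      by (simp only: sum.distrib sum.inter_restrict[OF finite_atLeastAtMost] mem_Collect_eq)
    also have "{1..n} \<inter> {j. j \<in> Q} = {j. j \<in> Q \<and> 1 \<le> j \<and> j \<le> n}" by auto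
    also have "{1..n} \<inter> {j. j \<in> M \<and> l j > 0} = {j. j \<in> M \<and> 1 \<le> j \<and> j \<le> n \<and> l j > 0}" by auto
    finally show ?thesis .
  qed
  show ?thesis
  proof (cases "L \<le> n")
    case False
    have "(\<Sum>j | j \<in> Q \<and> 1 \<le> j \<and> j \<le> n. u l (n - j)) = 0"
      by (rule sum.neutral) (use False in \<open>auto simp: u simp flip: L_def\<close>)
    moreover have "(\<Sum>j | j \<in> M \<and> 1 \<le> j \<and> j \<le> n \<and> l j > 0. u (l(j := l j - 1)) (n - j)) = 0"
    proof (rule sum.neutral, clarify)
      fix j assume "j \<in> M" "1 \<le> j" "j \<le> n" "l j > 0"
      then have "\<not> ?s (l(j := l j - 1)) \<le> n - j" using dec[of j] False by linarith
      then show "u (l(j := l j - 1)) (n - j) = 0" by (simp only: u if_False mult_zero_right)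
    qed
    moreover have "u l n = 0" using False by (simp add: u L_def)
    ultimately show ?thesis unfolding split by simp
  next
    case True
    have "(\<Sum>j | j \<in> Q \<and> 1 \<le> j \<and> j \<le> n. u l (n - j))
        = (\<Sum>j | j \<in> Q \<and> 1 \<le> j \<and> j \<le> n - L. ?c * ?F $ (n - L - j))"
      by (rule sum.mono_neutral_cong_right) (use True in \<open>auto simp: u L_def[symmetric] add.commute\<close>)
    also have "\<dots> = ?c * (real (n - L) * ?F $ (n - L))"
      by (simp only: cycle_egf_rec sum_distrib_left)
    finally have 1: "(\<Sum>j | j \<in> Q \<and> 1 \<le> j \<and> j \<le> n. u l (n - j))
        = ?c * (real (n - L) * ?F $ (n - L))" .
    have "(\<Sum>j | j \<in> M \<and> 1 \<le> j \<and> j \<le> n \<and> l j > 0. u (l(j := l j - 1)) (n - j))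
        = (\<Sum>j\<in>M. real (j * l j) * (?c * ?F $ (n - L)))"
    proof (rule sum.mono_neutral_cong_left[OF M(1)])
      show "\<forall>j\<in>M - {j \<in> M. 1 \<le> j \<and> j \<le> n \<and> l j > 0}. real (j * l j) * (?c * ?F $ (n - L)) = 0"
      proof
        fix j assume j: "j \<in> M - {j \<in> M. 1 \<le> j \<and> j \<le> n \<and> l j > 0}"
        have "l j = 0"
        proof (rule ccontr)
          assume "l j \<noteq> 0"
          then have "j \<le> L" using dec[of j] j by simp
          moreover have "j \<noteq> 0" using j M(2) by (metis DiffD1)
          ultimately show False using j True \<open>l j \<noteq> 0\<close> by simp
        qed
        then show "real (j * l j) * (?c * ?F $ (n - L)) = 0" by simp
      qed
      fix j assume "j \<in> {j \<in> M. 1 \<le> j \<and> j \<le> n \<and> l j > 0}"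
      then have j: "j \<in> M" "0 < j" "j \<le> n" "l j > 0" by auto
      have "?s (l(j := l j - 1)) \<le> n - j" "n - j - ?s (l(j := l j - 1)) = n - L"
        using dec[OF j(1,4)] j(3) True by linarith+
      then have "u (l(j := l j - 1)) (n - j) = cauchy_coeff M (l(j := l j - 1)) * ?F $ (n - L)"
        by (simp only: u if_True)
      then show "u (l(j := l j - 1)) (n - j) = real (j * l j) * (?c * ?F $ (n - L))"
        by (simp only: cauchy_coeff_decrease[where l = l, OF M(1) j(1,2,4)] mult.assoc)
    qed auto
    also have "\<dots> = real L * (?c * ?F $ (n - L))"
      by (simp add: L_def sum_distrib_right)
    finally have 2: "(\<Sum>j | j \<in> M \<and> 1 \<le> j \<and> j \<le> n \<and> l j > 0. u (l(j := l j - 1)) (n - j))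
        = real L * (?c * ?F $ (n - L))" .
    show ?thesis
      unfolding split 1 2 using True unfolding u L_def[symmetric] by (simp add: of_nat_diff algebra_simps)
  qed
qed

text \<open>
  Cauchy's formula with free lengths \<open>Q\<close>. In the induction, the number of lists of length \<open>j\<close> is
  \<open>(N - 1)! / (N - 1 - j)!\<close>, and the induction hypothesis supplies the factor \<open>(N - 1 - j)!\<close>, so each
  length of the cycle through \<open>a\<close> gets the same weight \<open>(N - 1)!\<close>.
\<close>

lemma count_perms_eq:
  assumes M: "finite M" "0 \<notin> M" "M \<inter> Q = {}" and "finite A" and "\<And>k. k \<notin> M \<Longrightarrow> l k = 0"
  shows "real (count_perms A Q l) = fact (card A) * (cauchy_coeff M l *
        (if (\<Sum>k\<in>M. k * l k) \<le> card A then cycle_egf Q $ (card A - (\<Sum>k\<in>M. k * l k)) else 0))"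
proof -
  define u where "u l n = cauchy_coeff M l *
        (if (\<Sum>k\<in>M. k * l k) \<le> n then cycle_egf Q $ (n - (\<Sum>k\<in>M. k * l k)) else 0)" for l n
  have "real (count_perms A Q l) = fact (card A) * u l (card A)"
    using assms(4,5)
  proof (induction "card A" arbitrary: A l rule: less_induct)
    case less
    show ?case
    proof (cases "A = {}")
      case True
      have empty: "count_perms A Q l = (if \<forall>k. k \<notin> Q \<longrightarrow> 0 = l k then 1 else 0)"
        by (auto simp: True count_perms_def cycle_number_def)
      show ?thesis
      proof (cases "\<forall>k\<in>M. l k = 0")
        case z: True
        then have "\<forall>k. k \<notin> Q \<longrightarrow> 0 = l k" using less.prems(2) by metis
        moreover have "(\<Sum>k\<in>M. k * l k) = 0" "cauchy_coeff M l = 1"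
          using z by (simp_all add: cauchy_coeff_def)
        ultimately show ?thesis unfolding empty u_def by (simp add: True)
      next
        case nz: False
        then obtain k where k: "k \<in> M" "l k \<noteq> 0" by blast
        then have "k \<notin> Q" "k \<noteq> 0" using M by auto
        then have "\<not> (\<forall>k. k \<notin> Q \<longrightarrow> 0 = l k)" "(\<Sum>k\<in>M. k * l k) \<noteq> 0"
          using k M(1) by auto
        then show ?thesis unfolding empty u_def by (simp add: True)
      qed
    next
      case False
      then obtain a where a: "a \<in> A" by blast
      define N where "N = card A"
      have N: "0 < N" using False less.prems(1) by (simp add: N_def card_gt_0_iff)
      define v where "v j = (if j \<in> Q then u l (N - j)
           else if j \<in> M \<and> l j > 0 then u (l(j := l j - 1)) (N - j) else 0)" for j
      let ?P = "{xs. distinct xs \<and> set xs \<subseteq> A - {a}}"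
      have finP: "finite ?P"
        by (rule finite_subset[OF _ finite_subset_distinct[of "A - {a}"]]) (use less.prems in auto)
      have len: "length xs < N" and card: "card (A - set (a # xs)) = N - Suc (length xs)"
        if "xs \<in> ?P" for xs
      proof -
        have xs: "distinct (a # xs)" "set (a # xs) \<subseteq> A" using that a by auto
        then show "card (A - set (a # xs)) = N - Suc (length xs)"
          unfolding N_def using less.prems(1)
          by (metis List.finite_set card_Diff_subset distinct_card length_Cons)
        show "length xs < N" unfolding N_def
          using card_mono[OF less.prems(1) xs(2)] distinct_card[OF xs(1)] by simp
      qed
      have "real (count_perms A Q l) = (\<Sum>xs\<in>?P. fact (N - Suc (length xs)) * v (Suc (length xs)))"
        unfolding count_perms_rec[OF less.prems(1) a] of_nat_sum
      proof (rule sum.cong[OF refl])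
        fix xs assume xs: "xs \<in> ?P"
        let ?B = "A - set (a # xs)" and ?k = "Suc (length xs)"
        have IH: "real (count_perms ?B Q l') = fact (N - ?k) * u l' (N - ?k)"
          if "\<And>k. k \<notin> M \<Longrightarrow> l' k = 0" for l'
        proof -
          have "card ?B < card A" using card[OF xs] N unfolding N_def by linarith
          moreover have "finite ?B" using less.prems(1) by (rule finite_Diff)
          ultimately have "real (count_perms ?B Q l') = fact (card ?B) * u l' (card ?B)"
            using that by (rule less.hyps)
          then show ?thesis by (simp only: card[OF xs])
        qed
        have M_if: "?k \<in> M" if "l ?k \<noteq> 0" using that less.prems(2) by (rule contrapos_np)
        have IH': "real (count_perms ?B Q l) = fact (N - ?k) * u l (N - ?k)"
          "real (count_perms ?B Q (l(?k := l ?k - 1))) = fact (N - ?k) * u (l(?k := l ?k - 1)) (N - ?k)"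
        proof -
          show "real (count_perms ?B Q l) = fact (N - ?k) * u l (N - ?k)"
            by (rule IH) (fact less.prems(2))
          have "(l(?k := l ?k - 1)) k = 0" if "k \<notin> M" for k
            using less.prems(2)[OF that] by (cases "k = ?k") (simp_all del: One_nat_def)
          then show "real (count_perms ?B Q (l(?k := l ?k - 1)))
              = fact (N - ?k) * u (l(?k := l ?k - 1)) (N - ?k)"
            by (rule IH)
        qed
        show "real (let B = ?B; k = ?k in if k \<in> Q then count_perms B Q l
            else if l k = 0 then 0 else count_perms B Q (l(k := l k - 1)))
          = fact (N - ?k) * v ?k"
        proof (cases "?k \<in> Q \<or> l ?k = 0")
          case True
          then show ?thesis using IH' by (auto simp: Let_def v_def simp del: list.set)
        next
          case False
          then have "?k \<notin> Q" "?k \<in> M" "l ?k \<noteq> 0" "0 < l ?k" using M_if by simp_all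
          then show ?thesis unfolding Let_def v_def using IH'(2) by (simp only: if_False if_True simp_thms)
        qed
      qed
      also have "\<dots> = (\<Sum>j<N. \<Sum>xs | xs \<in> ?P \<and> length xs = j. fact (N - Suc (length xs)) * v (Suc (length xs)))"
        by (rule sum.group[OF finP, symmetric]) (use len in auto)
      also have "\<dots> = (\<Sum>j<N. fact (N - 1) * v (Suc j))"
      proof (rule sum.cong[OF refl])
        fix j assume "j \<in> {..<N}"
        then have j: "j \<le> N - 1" "j < N" by auto
        have "card (A - {a}) = N - 1" using a less.prems(1) by (simp add: N_def)
        then have "card {xs. length xs = j \<and> distinct xs \<and> set xs \<subseteq> A - {a}} = \<Prod>{N - 1 - j + 1..N - 1}"
          using card_lists_distinct_length_eq[of "A - {a}" j] j less.prems(1) by simp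
        moreover have "{xs. xs \<in> ?P \<and> length xs = j} = {xs. length xs = j \<and> distinct xs \<and> set xs \<subseteq> A - {a}}"
          by auto
        moreover have "\<Prod>{N - 1 - j + 1..N - 1} * fact (N - Suc j) = (fact (N - 1) :: nat)"
        proof -
          have "{1..N - 1} = {1..N - 1 - j} \<union> {N - 1 - j + 1..N - 1}" using j by auto
          then have "\<Prod>{1..N - 1} = \<Prod>{1..N - 1 - j} * \<Prod>{N - 1 - j + 1..N - 1}"
            by (simp add: prod.union_disjoint del: Suc_pred)
          then show ?thesis by (simp add: fact_prod mult.commute)
        qed
        ultimately have card_fact: "card {xs. xs \<in> ?P \<and> length xs = j} * fact (N - Suc j) = (fact (N - 1) :: nat)"
          by metis
        have "(\<Sum>xs | xs \<in> ?P \<and> length xs = j. fact (N - Suc (length xs)) * v (Suc (length xs)))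
            = (\<Sum>xs | xs \<in> ?P \<and> length xs = j. fact (N - Suc j) * v (Suc j))"
          by (rule sum.cong) auto
        also have "\<dots> = real (card {xs. xs \<in> ?P \<and> length xs = j} * fact (N - Suc j)) * v (Suc j)"
          by simp
        finally show "(\<Sum>xs | xs \<in> ?P \<and> length xs = j. fact (N - Suc (length xs)) * v (Suc (length xs)))
            = fact (N - 1) * v (Suc j)"
          unfolding card_fact by simp
      qed
      also have "\<dots> = fact (N - 1) * (\<Sum>j=1..N. v j)"
        unfolding sum_distrib_left[symmetric]
        by (simp add: sum.atLeast1_atMost_eq)
      also have "(\<Sum>j=1..N. v j) = real N * u l N"
        unfolding v_def by (rule cycle_type_series_rec[OF M N u_def, symmetric])
      also have "fact (N - 1) * (real N * u l N) = fact N * u l N"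
        using N by (simp add: fact_reduce)
      finally show ?thesis unfolding N_def .
    qed
  qed
  then show ?thesis unfolding u_def .
qed

section \<open>Log-concavity of the probability of having only short cycles\<close>

text \<open>
  The probability that a uniformly random permutation of \<open>N\<close> points has no cycle longer than \<open>b\<close>.
  It is the discrete counterpart of the Dickman function at \<open>N / b\<close>.
\<close>

definition bounded_coeff :: "nat \<Rightarrow> nat \<Rightarrow> real" where
  "bounded_coeff b N = cycle_egf {1..b} $ N"

definition coeff_ratio :: "nat \<Rightarrow> nat \<Rightarrow> real" where
  "coeff_ratio b N = bounded_coeff b (N - 1) / bounded_coeff b N"

lemma bounded_coeff_rec:
  assumes "b \<le> N"
  shows "real N * bounded_coeff b N = (\<Sum>j=1..b. bounded_coeff b (N - j))"
proof -
  have "{j. j \<in> {1..b} \<and> 1 \<le> j \<and> j \<le> N} = {1..b}" using assms by auto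
  then show ?thesis unfolding bounded_coeff_def cycle_egf_rec by simp
qed

lemma bounded_coeff_eq_1:
  assumes "N \<le> b"
  shows "bounded_coeff b N = 1"
  using assms
proof (induction N rule: less_induct)
  case (less N)
  show ?case
  proof (cases "N = 0")
    case False
    have "real N * bounded_coeff b N = (\<Sum>j | j \<in> {1..b} \<and> 1 \<le> j \<and> j \<le> N. bounded_coeff b (N - j))"
      unfolding bounded_coeff_def cycle_egf_rec ..
    also have "\<dots> = (\<Sum>j=1..N. 1)"
      by (rule sum.cong) (use less in auto)
    finally show ?thesis using False by simp
  qed (simp add: bounded_coeff_def)
qed

lemma bounded_coeff_pos:
  assumes "1 \<le> b"
  shows "0 < bounded_coeff b N"
proof (induction N)
  case (Suc N)
  have "bounded_coeff b (Suc N - 1) \<le> (\<Sum>j | j \<in> {1..b} \<and> 1 \<le> j \<and> j \<le> Suc N. bounded_coeff b (Suc N - j))"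
    by (rule member_le_sum[of 1])
       (use assms cycle_egf_nonneg in \<open>auto simp: bounded_coeff_def\<close>)
  also have "\<dots> = real (Suc N) * bounded_coeff b (Suc N)"
    unfolding bounded_coeff_def cycle_egf_rec ..
  finally have "0 < real (Suc N) * bounded_coeff b (Suc N)" using Suc by simp
  then show ?case by (simp only: zero_less_mult_iff of_nat_0_less_iff) linarith
qed (simp add: bounded_coeff_def)

text \<open>
  The difference of two consecutive instances of \<open>bounded_coeff_rec\<close>, a discrete form of the Dickman
  delay equation \<open>u \<rho>'(u) = - \<rho>(u - 1)\<close>.
\<close>

lemma bounded_coeff_Suc:
  assumes "1 \<le> b" "b \<le> N"
  shows "real (Suc N) * bounded_coeff b (Suc N) = real (Suc N) * bounded_coeff b N - bounded_coeff b (N - b)"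
proof -
  let ?h = "bounded_coeff b"
  have "real (Suc N) * ?h (Suc N) = (\<Sum>j=1..b. ?h (Suc N - j))"
    by (rule bounded_coeff_rec) (use assms in simp)
  also have "\<dots> = (\<Sum>j<b. ?h (N - j))"
    by (simp add: sum.atLeast1_atMost_eq)
  also have "\<dots> = ?h N + (\<Sum>j=1..b. ?h (N - j)) - ?h (N - b)"
  proof -
    have "(\<Sum>j<Suc b. ?h (N - j)) = ?h N + (\<Sum>j<b. ?h (N - Suc j))"
      by (simp only: sum.lessThan_Suc_shift) simp
    then show ?thesis by (simp add: sum.atLeast1_atMost_eq)
  qed
  finally show ?thesis unfolding bounded_coeff_rec[OF assms(2), symmetric] by (simp add: algebra_simps)
qed

lemma coeff_ratio_mono_upto:
  assumes "\<And>M. 1 \<le> M \<Longrightarrow> M < N \<Longrightarrow> coeff_ratio b M \<le> coeff_ratio b (Suc M)"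
    and "1 \<le> i" "i \<le> j" "j \<le> N"
  shows "coeff_ratio b i \<le> coeff_ratio b j"
  using assms(3,4)
proof (induction j rule: dec_induct)
  case (step k)
  then have "coeff_ratio b i \<le> coeff_ratio b k" by simp
  also have "\<dots> \<le> coeff_ratio b (Suc k)" using assms(1)[of k] step assms(2) by simp
  finally show ?case .
qed simp

text \<open>
  Log-concavity, by strong induction. For \<open>N > b\<close> let \<open>a, c, d\<close> be the values of
  \<open>bounded_coeff b\<close> at \<open>N - 1, N, N + 1\<close> and \<open>e, f\<close> those at \<open>N - b, N - b - 1\<close>. Eliminating \<open>d\<close> and one factor \<open>c\<close> by the delay equation gives
  \<open>N (N + 1) (c\<^sup>2 - a d) = N a e - (N + 1) c f\<close>. By the recursion, \<open>N a\<close> and \<open>(N + 1) c\<close> are sums of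
  the values at \<open>N - 1 - j\<close> and \<open>N - j\<close> with \<open>0 \<le> j \<le> b\<close>, and the difference is nonnegative term by
  term, because the ratio at \<open>N - j\<close> is at least the one at \<open>N - b\<close> by induction.
\<close>

lemma coeff_ratio_le_Suc:
  assumes b: "1 \<le> b" and "1 \<le> N"
  shows "coeff_ratio b N \<le> coeff_ratio b (Suc N)"
  using assms(2)
proof (induction N rule: less_induct)
  case (less N)
  let ?h = "bounded_coeff b"
  note pos = bounded_coeff_pos[OF b]
  show ?case
  proof (cases "N \<le> b")
    case True
    have "?h (Suc N) \<le> 1"
    proof (cases "N = b")
      case eq: True
      have "real (Suc N) * ?h (Suc N) \<le> real (Suc N) * 1"
        using bounded_coeff_Suc[OF b, of N] pos[of "N - b"] bounded_coeff_eq_1[OF True] eq by simp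
      then show ?thesis by simp
    qed (use True bounded_coeff_eq_1[of "Suc N" b] in simp)
    then show ?thesis
      using True pos[of "Suc N"] by (simp add: coeff_ratio_def bounded_coeff_eq_1 divide_simps)
  next
    case False
    then have N: "b < N" by simp
    define a c d e f where "a = ?h (N - 1)" "c = ?h N" "d = ?h (Suc N)"
      "e = ?h (N - b)" "f = ?h (N - b - 1)"
    note defs = this
    have cross: "?h (N - j) * f \<le> ?h (N - 1 - j) * e" if "j \<le> b" for j
    proof -
      have "coeff_ratio b (N - b) \<le> coeff_ratio b (N - j)"
        by (rule coeff_ratio_mono_upto[of N]) (use less N that in auto)
      then show ?thesis
        using pos[of "N - b"] pos[of "N - j"]
        by (simp add: coeff_ratio_def defs divide_simps mult.commute diff_commute)
    qed
    have d: "real (Suc N) * d = real (Suc N) * c - e"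
      using bounded_coeff_Suc[OF b, of N] N by (simp add: defs)
    have c: "real N * c = real N * a - f"
      using bounded_coeff_Suc[OF b, of "N - 1"] N by (simp add: defs)
    have S: "real N * c = (\<Sum>j=1..b. ?h (N - j))"
      unfolding defs by (rule bounded_coeff_rec) (use N in simp)
    have T: "real (N - 1) * a = (\<Sum>j=1..b. ?h (N - 1 - j))"
      unfolding defs by (rule bounded_coeff_rec) (use N in simp)
    have "0 \<le> (a * e - c * f) + (\<Sum>j=1..b. ?h (N - 1 - j) * e - ?h (N - j) * f)"
      using cross[of 0] cross by (intro add_nonneg_nonneg sum_nonneg) (auto simp: defs)
    also have "\<dots> = (a + real (N - 1) * a) * e - (c + real N * c) * f"
      unfolding S T by (simp add: sum_subtractf distrib_right flip: sum_distrib_right)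
    also have "\<dots> = real N * a * e - real (Suc N) * c * f"
      using less.prems by (simp add: of_nat_diff algebra_simps)
    also have "\<dots> = real N * (real (Suc N) * (c * c - a * d))"
    proof -
      have "real (Suc N) * (c * c - a * d) = real (Suc N) * c * c - a * (real (Suc N) * d)"
        by (simp add: algebra_simps)
      also have "\<dots> = real (Suc N) * c * (c - a) + a * e"
        unfolding d by (simp add: algebra_simps)
      finally have "real (Suc N) * (c * c - a * d) = real (Suc N) * c * (c - a) + a * e" .
      then have "real N * (real (Suc N) * (c * c - a * d))
          = real N * (real (Suc N) * c * (c - a) + a * e)"
        by (simp only:)
      also have "\<dots> = real (Suc N) * c * (real N * c - real N * a) + real N * a * e"
        by (simp only: distrib_left right_diff_distrib mult.left_commute mult.assoc)
      finally have "real N * (real (Suc N) * (c * c - a * d))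
          = real (Suc N) * c * (real N * c - real N * a) + real N * a * e" .
      then show ?thesis unfolding c by (simp add: algebra_simps)
    qed
    finally have "a * d \<le> c * c"
      using less.prems by (simp add: zero_le_mult_iff)
    then show ?thesis
      using pos[of N] pos[of "Suc N"] by (simp add: coeff_ratio_def defs divide_simps)
  qed
qed

lemma coeff_ratio_mono:
  assumes "1 \<le> b" "1 \<le> i" "i \<le> j"
  shows "coeff_ratio b i \<le> coeff_ratio b j"
  by (rule coeff_ratio_mono_upto[of j]) (use assms coeff_ratio_le_Suc in auto)

lemma coeff_ratio_pos: "1 \<le> b \<Longrightarrow> 0 < coeff_ratio b N"
  by (simp add: coeff_ratio_def bounded_coeff_pos)

lemma bounded_coeff_diff_le:
  assumes b: "1 \<le> b" and "L \<le> n"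
  shows "bounded_coeff b (n - L) \<le> coeff_ratio b n ^ L * bounded_coeff b n"
  using assms(2)
proof (induction L)
  case (Suc L)
  have "bounded_coeff b (n - Suc L) = coeff_ratio b (n - L) * bounded_coeff b (n - L)"
    using bounded_coeff_pos[OF b, of "n - L"] by (simp add: coeff_ratio_def)
  also have "\<dots> \<le> coeff_ratio b n * (coeff_ratio b n ^ L * bounded_coeff b n)"
    using Suc coeff_ratio_pos[OF b, of n] bounded_coeff_pos[OF b, of "n - L"]
    by (intro mult_mono coeff_ratio_mono[OF b]) (auto intro: less_imp_le)
  finally show ?case by (simp add: mult.assoc)
qed simp

lemma bounded_coeff_diff_ge:
  assumes b: "1 \<le> b" and "1 \<le> N" "N + L \<le> Suc n"
  shows "coeff_ratio b N ^ L * bounded_coeff b n \<le> bounded_coeff b (n - L)"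
  using assms(3)
proof (induction L)
  case (Suc L)
  have "coeff_ratio b N * (coeff_ratio b N ^ L * bounded_coeff b n)
      \<le> coeff_ratio b (n - L) * bounded_coeff b (n - L)"
    using Suc assms(2) coeff_ratio_pos[OF b] bounded_coeff_pos[OF b]
    by (intro mult_mono coeff_ratio_mono[OF b]) (auto intro: less_imp_le mult_nonneg_nonneg)
  also have "\<dots> = bounded_coeff b (n - Suc L)"
    using bounded_coeff_pos[OF b, of "n - L"] by (simp add: coeff_ratio_def)
  finally show ?case by (simp add: mult.assoc)
qed simp

section \<open>Ratios of coefficients and the saddle point\<close>

lemma power_sum_strict_mono:
  fixes x y :: real
  assumes "1 \<le> b" "0 \<le> x" "x < y"
  shows "(\<Sum>j=1..b. x ^ j) < (\<Sum>j=1..b. y ^ j)"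
  by (rule sum_strict_mono) (use assms in \<open>auto intro!: power_strict_mono\<close>)

lemma power_sum_le_imp_le:
  fixes x y :: real
  assumes "1 \<le> b" "0 \<le> y" "(\<Sum>j=1..b. x ^ j) \<le> (\<Sum>j=1..b. y ^ j)"
  shows "x \<le> y"
  using power_sum_strict_mono[of b y x] assms by force

text \<open>
  By monotonicity, each of the \<open>j\<close> ratios in \<open>h (N - j) / h N\<close> is at most the last one, so the
  recursion yields \<open>N \<le> \<Sum>j. r N ^ j\<close>.
\<close>

lemma saddle_le_coeff_ratio:
  assumes b: "1 \<le> b" and N: "b \<le> N" and x: "(\<Sum>j=1..b. x ^ j) = real N"
  shows "x \<le> coeff_ratio b N"
proof (rule power_sum_le_imp_le[OF b])
  let ?h = "bounded_coeff b"
  have "real N * ?h N = (\<Sum>j=1..b. ?h (N - j))" by (rule bounded_coeff_rec[OF N])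
  also have "\<dots> \<le> (\<Sum>j=1..b. coeff_ratio b N ^ j * ?h N)"
    by (rule sum_mono) (use N bounded_coeff_diff_le[OF b] in auto)
  also have "\<dots> = (\<Sum>j=1..b. coeff_ratio b N ^ j) * ?h N" by (simp add: sum_distrib_right)
  finally show "(\<Sum>j=1..b. x ^ j) \<le> (\<Sum>j=1..b. coeff_ratio b N ^ j)"
    unfolding x using bounded_coeff_pos[OF b, of N] by simp
qed (use coeff_ratio_pos[OF b] in \<open>auto intro: less_imp_le\<close>)

text \<open>
  In the recursion at \<open>N + b - 1\<close> all ratios have index at least \<open>N\<close>, which explains the shift.
\<close>

lemma coeff_ratio_le_saddle:
  assumes b: "1 \<le> b" and N: "1 \<le> N" and x: "0 < x" "(\<Sum>j=1..b. x ^ j) = real (N + b - 1)"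
  shows "coeff_ratio b N \<le> x"
proof (rule power_sum_le_imp_le[OF b])
  let ?h = "bounded_coeff b" and ?K = "N + b - 1"
  have "(\<Sum>j=1..b. coeff_ratio b N ^ j) * ?h ?K = (\<Sum>j=1..b. coeff_ratio b N ^ j * ?h ?K)"
    by (simp add: sum_distrib_right)
  also have "\<dots> \<le> (\<Sum>j=1..b. ?h (?K - j))"
    by (rule sum_mono, rule bounded_coeff_diff_ge[OF b N]) (use N in simp)
  also have "\<dots> = real ?K * ?h ?K"
    by (rule bounded_coeff_rec[symmetric]) (use N in simp)
  finally show "(\<Sum>j=1..b. coeff_ratio b N ^ j) \<le> (\<Sum>j=1..b. x ^ j)"
    unfolding x using bounded_coeff_pos[OF b, of ?K] by simp
qed (use x in auto)

text \<open>
  With \<open>q = y / x\<close>, Bernoulli's inequality gives \<open>q ^ j \<ge> 1 + j (q - 1)\<close>, and Chebyshev's sum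
  inequality shows that the average of \<open>j\<close> with the increasing weights \<open>x ^ j\<close> is at least
  \<open>(b + 1) / 2\<close>. The factor \<open>1 / b\<close> in the bound is essential: powers of \<open>y / x\<close> of order \<open>b\<close> have
  to stay under control.
\<close>

lemma power_sum_growth:
  fixes x y :: real
  assumes b: "1 \<le> b" and x: "1 \<le> x" "x \<le> y"
  shows "y / x \<le> 1 + 2 * ((\<Sum>j=1..b. y ^ j) - (\<Sum>j=1..b. x ^ j)) / (real b * (\<Sum>j=1..b. x ^ j))"
proof -
  define q where "q = y / x"
  have q: "1 \<le> q" "y = q * x" using x by (auto simp: q_def)
  let ?S = "\<Sum>j=1..b. x ^ j"
  have S: "0 < ?S" by (rule sum_pos) (use b x in auto)
  have cheb: "(real b + 1) / 2 * ?S \<le> (\<Sum>j=1..b. real j * x ^ j)"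
  proof -
    have "real b * (\<Sum>k=0..<b. real (Suc k) * (- (x ^ Suc k)))
        \<le> (\<Sum>k=0..<b. real (Suc k)) * (\<Sum>k=0..<b. - (x ^ Suc k))"
      by (rule Chebyshev_sum_upper[where 'a = real]) (use x in \<open>auto intro!: power_increasing mult_left_mono\<close>)
    then have "(\<Sum>k=1..b. real k) * ?S \<le> real b * (\<Sum>j=1..b. real j * x ^ j)"
      by (simp add: sum_negf sum.atLeast1_atMost_eq lessThan_atLeast0)
    moreover have "(\<Sum>k=1..b. real k) = real b * ((real b + 1) / 2)"
      by (induction b) (simp_all add: field_simps)
    ultimately have "real b * ((real b + 1) / 2 * ?S) \<le> real b * (\<Sum>j=1..b. real j * x ^ j)"
      by (simp only: mult.assoc)
    then show ?thesis using b by (simp only: mult_le_cancel_left_pos of_nat_0_less_iff)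
  qed
  have "(q - 1) * (real b / 2 * ?S) \<le> (q - 1) * (\<Sum>j=1..b. real j * x ^ j)"
    using q S by (intro mult_left_mono order_trans[OF _ cheb]) auto
  also have "\<dots> = (\<Sum>j=1..b. (1 + real j * (q - 1)) * x ^ j) - ?S"
    by (simp add: algebra_simps sum.distrib sum_subtractf sum_distrib_left)
  also have "(\<Sum>j=1..b. (1 + real j * (q - 1)) * x ^ j) \<le> (\<Sum>j=1..b. y ^ j)"
  proof (rule sum_mono)
    fix j
    show "(1 + real j * (q - 1)) * x ^ j \<le> y ^ j"
      using Bernoulli_inequality[of "q - 1" j] q x
      by (simp add: q(2) power_mult_distrib mult_right_mono)
  qed
  finally have "(q - 1) * (real b / 2 * ?S) \<le> (\<Sum>j=1..b. y ^ j) - ?S" by simp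
  then have "q - 1 \<le> ((\<Sum>j=1..b. y ^ j) - ?S) / (real b / 2 * ?S)"
    using S b by (subst pos_le_divide_eq) auto
  also have "\<dots> = 2 * ((\<Sum>j=1..b. y ^ j) - ?S) / (real b * ?S)" by simp
  finally show ?thesis unfolding q_def by simp
qed

text \<open>
  The condition \<open>b \<le> s\<close> ensures \<open>1 \<le> x\<close>, so that the weights \<open>x ^ j\<close> increase.
\<close>

lemma saddle_growth:
  assumes b: "1 \<le> b" and s: "b \<le> s" "s \<le> t" and "0 < x" "0 < y"
    and x: "(\<Sum>j=1..b. x ^ j) = real s" and y: "(\<Sum>j=1..b. y ^ j) = real t"
  shows "y \<le> x * exp (2 * (real t - real s) / (real b * real s))"
proof -
  have "1 \<le> x" by (rule power_sum_le_imp_le[OF b]) (use assms in auto)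
  moreover have "x \<le> y" by (rule power_sum_le_imp_le[OF b]) (use assms in auto)
  ultimately have "y / x \<le> 1 + 2 * (real t - real s) / (real b * real s)"
    using power_sum_growth[OF b, of x y, unfolded x y] by blast
  also have "\<dots> \<le> exp (2 * (real t - real s) / (real b * real s))"
    by (rule exp_ge_add_one_self)
  finally show ?thesis using \<open>0 < x\<close> by (simp add: pos_divide_le_eq mult.commute)
qed

lemma saddle_exists:
  assumes "1 \<le> b" "1 \<le> n"
  obtains x :: real where "0 < x" "(\<Sum>j=1..b. x ^ j) = real n"
proof -
  have "{j. 1 \<le> j \<and> real j \<le> real b} = {1..b}" by auto
  moreover have "1 \<le> real b" using assms(1) by simp
  ultimately have "\<exists>!x. 0 < x \<and> real n = (\<Sum>j=1..b. x ^ j)"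
    using saddle_point_ex1[OF assms(2), of "\<lambda>_. real b"] by simp
  then obtain x where "0 < x \<and> real n = (\<Sum>j=1..b. x ^ j)" by (elim ex1E)
  then show ?thesis by (intro that[of x]) simp_all
qed

text \<open>
  Every ratio up to \<open>n\<close> is at most the saddle point for \<open>n + b - 1\<close>, hence at most \<open>x exp (2 / n)\<close>.
  The bound holds for all \<open>L \<le> n\<close>, and its error factor is at most \<open>exp 2\<close>; this is the source of all
  dominating functions below.
\<close>

lemma bounded_coeff_shift_upper:
  assumes b: "1 \<le> b" "b \<le> n" and x: "0 < x" "(\<Sum>j=1..b. x ^ j) = real n" and L: "L \<le> n"
  shows "bounded_coeff b (n - L) \<le> bounded_coeff b n * x ^ L * exp (2 * real L / real n)"
proof -
  obtain y where y: "0 < y" "(\<Sum>j=1..b. y ^ j) = real (n + b - 1)"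
    by (rule saddle_exists[OF b(1), of "n + b - 1"]) (use b in simp)
  have "coeff_ratio b n \<le> y"
    using coeff_ratio_le_saddle[OF b(1) _ y] b by simp
  also have "y \<le> x * exp (2 * (real (n + b - 1) - real n) / (real b * real n))"
    by (rule saddle_growth[OF b(1) b(2) _ x(1) y(1) x(2) y(2)]) (use b in simp)
  also have "\<dots> \<le> x * exp (2 / real n)"
    using x b by (intro mult_left_mono) (auto simp: field_simps of_nat_diff)
  finally have r: "coeff_ratio b n \<le> x * exp (2 / real n)" .
  have "bounded_coeff b (n - L) \<le> coeff_ratio b n ^ L * bounded_coeff b n"
    by (rule bounded_coeff_diff_le[OF b(1) L])
  also have "\<dots> \<le> (x * exp (2 / real n)) ^ L * bounded_coeff b n"
    using r coeff_ratio_pos[OF b(1), of n] bounded_coeff_pos[OF b(1), of n]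
    by (intro mult_right_mono power_mono) (auto intro: less_imp_le)
  also have "\<dots> = bounded_coeff b n * x ^ L * exp (2 * real L / real n)"
    by (simp add: power_mult_distrib flip: exp_of_nat_mult)
  finally show ?thesis .
qed

text \<open>
  Every ratio from \<open>n - L\<close> on is at least the saddle point for \<open>n - L\<close>, which is close to the one for
  \<open>n\<close>. In contrast to the upper bound, this is sharp only for \<open>L\<close> small compared with \<open>sqrt (b n)\<close>.
\<close>

lemma bounded_coeff_shift_lower:
  assumes b: "1 \<le> b" and x: "0 < x" "(\<Sum>j=1..b. x ^ j) = real n" and L: "L + b \<le> n"
  shows "bounded_coeff b n * x ^ L * exp (- (2 * (real L)\<^sup>2 / (real b * real (n - L))))
           \<le> bounded_coeff b (n - L)"
proof -
  define t where "t = 2 * real L / (real b * real (n - L))"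
  obtain z where z: "0 < z" "(\<Sum>j=1..b. z ^ j) = real (n - L)"
    by (rule saddle_exists[OF b, of "n - L"]) (use b L in simp)
  have "x \<le> z * exp (2 * (real n - real (n - L)) / (real b * real (n - L)))"
    by (rule saddle_growth[OF b _ _ z(1) x(1) z(2) x(2)]) (use L in auto)
  then have "x * exp (- t) \<le> z"
    using L by (simp add: t_def exp_minus field_simps)
  also have "z \<le> coeff_ratio b (n - L)"
    by (rule saddle_le_coeff_ratio[OF b _ z(2)]) (use L in simp)
  finally have r: "x * exp (- t) \<le> coeff_ratio b (n - L)" .
  have "bounded_coeff b n * x ^ L * exp (- (2 * (real L)\<^sup>2 / (real b * real (n - L))))
      = (x * exp (- t)) ^ L * bounded_coeff b n"
    by (simp add: power_mult_distrib t_def power2_eq_square flip: exp_of_nat_mult)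
  also have "\<dots> \<le> coeff_ratio b (n - L) ^ L * bounded_coeff b n"
    using r x bounded_coeff_pos[OF b, of n]
    by (intro mult_right_mono power_mono) (auto intro: less_imp_le)
  also have "\<dots> \<le> bounded_coeff b (n - L)"
    by (rule bounded_coeff_diff_ge[OF b]) (use L b in auto)
  finally show ?thesis .
qed

section \<open>Limits of normalised coefficients\<close>

text \<open>
  The growth conditions on \<open>\<alpha>\<close> enter the limit theorems only through \<open>1 \<le> b n\<close> and
  \<open>b n / n \<longlonglongrightarrow> 0\<close>, where \<open>b n\<close> is the integer part of \<open>\<alpha> n\<close>.
\<close>

locale saddle_sequence =
  fixes b :: "nat \<Rightarrow> nat" and x :: "nat \<Rightarrow> real"
  assumes bound_pos: "\<forall>\<^sub>F n in sequentially. 1 \<le> b n"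
    and saddle_pos: "\<forall>\<^sub>F n in sequentially. 0 < x n"
    and saddle_eq: "\<forall>\<^sub>F n in sequentially. (\<Sum>j=1..b n. x n ^ j) = real n"
    and bound_small: "(\<lambda>n. real (b n) / real n) \<longlonglongrightarrow> 0"
begin

text \<open>
  The coefficient of index \<open>n - L\<close> divided by its expected order of magnitude. Coefficients of negative index
  count as 0, so that the inclusion-exclusion sums can run over all natural numbers.
\<close>

definition norm_coeff :: "nat set \<Rightarrow> nat \<Rightarrow> nat \<Rightarrow> real" where
  "norm_coeff Q n L = (if L \<le> n then cycle_egf Q $ (n - L) else 0) / (bounded_coeff (b n) n * x n ^ L)"

lemma bound_le: "\<forall>\<^sub>F n in sequentially. b n \<le> n"
  using order_tendstoD(2)[OF bound_small zero_less_one] eventually_gt_at_top[of 0]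
  by eventually_elim (simp add: divide_simps)

text \<open>
  The bound is uniform in \<open>L\<close> because it has to dominate both the inclusion-exclusion sums and the
  sum over all values of the count vector.
\<close>

lemma norm_coeff_bounds:
  "\<forall>\<^sub>F n in sequentially. \<forall>Q L. Q \<subseteq> {1..b n} \<longrightarrow> 0 \<le> norm_coeff Q n L \<and> norm_coeff Q n L \<le> exp 2"
  using bound_pos bound_le saddle_pos saddle_eq eventually_gt_at_top[of 0]
proof eventually_elim
  case (elim n)
  have pos: "0 < bounded_coeff (b n) n * x n ^ L" for L
    using bounded_coeff_pos[OF elim(1)] elim(3) by simp
  show ?case
  proof (intro allI impI conjI)
    fix Q L assume Q: "Q \<subseteq> {1..b n}"
    show "0 \<le> norm_coeff Q n L"
      using pos[of L] cycle_egf_nonneg unfolding norm_coeff_def by (auto intro!: divide_nonneg_pos)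
    show "norm_coeff Q n L \<le> exp 2"
    proof (cases "L \<le> n")
      case True
      have "cycle_egf Q $ (n - L) \<le> bounded_coeff (b n) (n - L)"
        unfolding bounded_coeff_def by (rule cycle_egf_mono[OF Q])
      also have "\<dots> \<le> bounded_coeff (b n) n * x n ^ L * exp (2 * real L / real n)"
        by (rule bounded_coeff_shift_upper[OF elim(1-4) True])
      also have "\<dots> \<le> bounded_coeff (b n) n * x n ^ L * exp 2"
        using pos[of L] True elim(5) by (intro mult_left_mono) (auto simp: divide_simps)
      finally show ?thesis
        using pos[of L] True unfolding norm_coeff_def by (simp add: pos_divide_le_eq mult.commute)
    qed (simp add: norm_coeff_def)
  qed
qed

text \<open>
  For \<open>L = O(b)\<close> both error exponents, \<open>L / n\<close> and \<open>L\<^sup>2 / (b (n - L))\<close>, are of order \<open>b / n\<close>.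
\<close>

lemma norm_coeff_full_tendsto:
  assumes L: "\<forall>\<^sub>F n in sequentially. L n \<le> C * b n"
  shows "(\<lambda>n. norm_coeff {1..b n} n (L n)) \<longlonglongrightarrow> 1"
proof -
  \<comment> \<open>an upper bound for \<open>L n / n\<close>\<close>
  define r where "r n = real C * (real (b n) / real n)" for n
  have r: "r \<longlonglongrightarrow> 0"
    unfolding r_def using tendsto_mult[OF tendsto_const[of "real C"] bound_small] by simp
  have "(\<lambda>n. exp (- (2 * (real C * r n / (1 - r n))))) \<longlonglongrightarrow> exp (- (2 * (real C * 0 / (1 - 0))))"
    by (intro tendsto_intros r) simp
  then have lower: "(\<lambda>n. exp (- (2 * (real C * r n / (1 - r n))))) \<longlonglongrightarrow> 1" by simp
  have "(\<lambda>n. exp (2 * r n)) \<longlonglongrightarrow> exp (2 * 0)" by (intro tendsto_intros r)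
  then have upper: "(\<lambda>n. exp (2 * r n)) \<longlonglongrightarrow> 1" by simp
  have small: "\<forall>\<^sub>F n in sequentially. r n < 1"
    using order_tendstoD(2)[OF r zero_less_one] .
  \<comment> \<open>One more multiple of \<open>b n\<close> keeps \<open>n - L n\<close> above \<open>b n\<close>, as the lower bound requires.\<close>
  have "(\<lambda>n. real (Suc C) * (real (b n) / real n)) \<longlonglongrightarrow> 0"
    using tendsto_mult[OF tendsto_const[of "real (Suc C)"] bound_small] by simp
  then have "\<forall>\<^sub>F n in sequentially. real (Suc C) * (real (b n) / real n) < 1"
    using order_tendstoD(2)[OF _ zero_less_one] by blast
  then have room: "\<forall>\<^sub>F n in sequentially. L n + b n \<le> n"
    using L eventually_gt_at_top[of 0]
  proof eventually_elim
    case (elim n)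
    then have "real (Suc C) * real (b n) < real n" by (simp add: divide_simps)
    then have "Suc C * b n < n" by (metis of_nat_less_iff of_nat_mult)
    then show ?case using elim(2) by simp
  qed
  show ?thesis
  proof (rule tendsto_sandwich[OF _ _ lower upper])
    show "\<forall>\<^sub>F n in sequentially. norm_coeff {1..b n} n (L n) \<le> exp (2 * r n)"
      using bound_pos bound_le saddle_pos saddle_eq eventually_gt_at_top[of 0] L room
    proof eventually_elim
      case (elim n)
      have pos: "0 < bounded_coeff (b n) n * x n ^ L n"
        using bounded_coeff_pos[OF elim(1)] elim(3) by simp
      have "bounded_coeff (b n) (n - L n) \<le> bounded_coeff (b n) n * x n ^ L n * exp (2 * real (L n) / real n)"
        by (rule bounded_coeff_shift_upper[OF elim(1-4)]) (use elim(7) in simp)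
      then have "norm_coeff {1..b n} n (L n) \<le> exp (2 * real (L n) / real n)"
        using pos elim(7) unfolding norm_coeff_def bounded_coeff_def
        by (simp add: pos_divide_le_eq mult.commute)
      also have "\<dots> \<le> exp (2 * r n)"
      proof -
        have "real (L n) \<le> real C * real (b n)" using elim(6) by (metis of_nat_le_iff of_nat_mult)
        then show ?thesis using elim(5) unfolding r_def by (simp add: divide_right_mono)
      qed
      finally show ?case .
    qed
    show "\<forall>\<^sub>F n in sequentially. exp (- (2 * (real C * r n / (1 - r n)))) \<le> norm_coeff {1..b n} n (L n)"
      using bound_pos saddle_pos saddle_eq eventually_gt_at_top[of 0] L room small
    proof eventually_elim
      case (elim n)
      have pos: "0 < bounded_coeff (b n) n * x n ^ L n"
        using bounded_coeff_pos[OF elim(1)] elim(2) by simp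
      have LC: "real (L n) \<le> real C * real (b n)" using elim(5) by (metis of_nat_le_iff of_nat_mult)
      have b0: "0 < real (b n)" using elim(1) by simp
      have den: "real n * (1 - r n) \<le> real (n - L n)"
        using LC elim(4,6) by (simp add: r_def of_nat_diff right_diff_distrib)
      have den_pos: "0 < real n * (1 - r n)" using elim(4,7) by simp
      have "(real (L n))\<^sup>2 / (real (b n) * real (n - L n))
          \<le> (real C * real (b n))\<^sup>2 / (real (b n) * (real n * (1 - r n)))"
        using LC b0 den by (intro frac_le power_mono mult_left_mono mult_pos_pos[OF b0 den_pos]) auto
      also have "\<dots> = real C * r n / (1 - r n)"
        using b0 by (simp add: r_def power2_eq_square)
      finally have "exp (- (2 * (real C * r n / (1 - r n))))
          \<le> exp (- (2 * (real (L n))\<^sup>2 / (real (b n) * real (n - L n))))" by simp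
      also have "\<dots> \<le> norm_coeff {1..b n} n (L n)"
        using bounded_coeff_shift_lower[OF elim(1-3,6)] pos elim(6)
        unfolding norm_coeff_def bounded_coeff_def by (simp add: pos_le_divide_eq mult.commute)
      finally show ?case .
    qed
  qed
qed

lemma norm_coeff_remove:
  assumes "0 < x n" "0 < m" "m \<in> Q"
  shows "(\<lambda>k. (- (x n ^ m / real m)) ^ k / fact k * norm_coeff Q n (L + k * m))
           sums norm_coeff (Q - {m}) n L"
proof -
  let ?K = "{k. L + k * m \<le> n}" and ?d = "bounded_coeff (b n) n"
  have fin: "finite ?K"
  proof (rule finite_subset)
    show "?K \<subseteq> {..n}"
    proof
      fix k assume "k \<in> ?K"
      moreover have "k * 1 \<le> k * m" using assms(2) by (intro mult_le_mono2) simp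
      ultimately show "k \<in> {..n}" unfolding mem_Collect_eq atMost_iff by linarith
    qed
  qed simp
  have "(\<lambda>k. (- (x n ^ m / real m)) ^ k / fact k * norm_coeff Q n (L + k * m))
      sums (\<Sum>k\<in>?K. (- (x n ^ m / real m)) ^ k / fact k * norm_coeff Q n (L + k * m))"
    by (rule sums_finite[OF fin]) (simp add: norm_coeff_def)
  also have "(\<Sum>k\<in>?K. (- (x n ^ m / real m)) ^ k / fact k * norm_coeff Q n (L + k * m))
      = norm_coeff (Q - {m}) n L"
  proof (cases "L \<le> n")
    case True
    have "norm_coeff (Q - {m}) n L
        = (\<Sum>k | k * m \<le> n - L. (- 1 / real m) ^ k / fact k * cycle_egf Q $ (n - L - k * m)) / (?d * x n ^ L)"
      using True by (simp only: norm_coeff_def if_True cycle_egf_remove_nth[OF assms(3,2)])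
    also have "\<dots> = (\<Sum>k\<in>?K. (- (x n ^ m / real m)) ^ k / fact k * norm_coeff Q n (L + k * m))"
      unfolding sum_divide_distrib
    proof (rule sum.cong)
      show "{k. k * m \<le> n - L} = ?K" using True by auto
      fix k assume "k \<in> ?K"
      then have k: "L + k * m \<le> n" by simp
      have "(- (x n ^ m / real m)) ^ k = (- 1 / real m) ^ k * x n ^ (k * m)"
        unfolding power_mult power_mult_distrib[symmetric] mult.commute[of k m] by simp
      then show "(- 1 / real m) ^ k / fact k * cycle_egf Q $ (n - L - k * m) / (?d * x n ^ L)
          = (- (x n ^ m / real m)) ^ k / fact k * norm_coeff Q n (L + k * m)"
        using k assms(1) by (simp add: norm_coeff_def power_add)
    qed
    finally show ?thesis by simp
  next
    case False
    then have "?K = {}" by auto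
    then show ?thesis using False by (simp add: norm_coeff_def)
  qed
  finally show ?thesis .
qed

text \<open>
  This agrees with \<open>cycle_mean\<close> if \<open>x n\<close> is the saddle point.
\<close>

definition mean_count :: "nat \<Rightarrow> nat \<Rightarrow> real" where
  "mean_count n m = x n ^ m / real m"

text \<open>
  Induction on the set of deleted lengths; the statement is for all sequences \<open>L\<close> with \<open>L = O(b)\<close>
  because the inclusion-exclusion terms for a further length \<open>m\<close> have indices \<open>L + k m\<close>. Subtracting
  1 from the limit relation turns it into a series of null sequences, as
  \<open>exp \<mu> * (\<Sum>k. (- \<mu>) ^ k / k!) = 1\<close>; this matters because \<open>\<mu>\<close> is bounded but
  need not converge. It is dominated by a multiple of the exponential series of \<open>B\<close>.
\<close>

lemma norm_coeff_remove_tendsto: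
  fixes m :: "'i \<Rightarrow> nat \<Rightarrow> nat"
  assumes S: "finite S"
    and range: "\<And>i. i \<in> S \<Longrightarrow> \<forall>\<^sub>F n in sequentially. m i n \<in> {1..b n}"
    and distinct: "\<And>i j. i \<in> S \<Longrightarrow> j \<in> S \<Longrightarrow> i \<noteq> j \<Longrightarrow> \<forall>\<^sub>F n in sequentially. m i n \<noteq> m j n"
    and mean: "\<And>i. i \<in> S \<Longrightarrow> \<forall>\<^sub>F n in sequentially. mean_count n (m i n) \<le> B"
    and L: "\<forall>\<^sub>F n in sequentially. L n \<le> C * b n"
  shows "(\<lambda>n. exp (\<Sum>i\<in>S. mean_count n (m i n))
            * norm_coeff ({1..b n} - (\<lambda>i. m i n) ` S) n (L n)) \<longlonglongrightarrow> 1"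
  using S range distinct mean L
proof (induction S arbitrary: L C rule: finite_induct)
  case empty
  then show ?case using norm_coeff_full_tendsto[of L C] by simp
next
  case (insert i S)
  define Q where "Q n = {1..b n} - (\<lambda>i. m i n) ` S" for n
  define E where "E n = exp (\<Sum>i\<in>S. mean_count n (m i n))" for n
  define \<mu> where "\<mu> n = mean_count n (m i n)" for n
  define g where "g k n = E n * norm_coeff (Q n) n (L n + k * m i n) - 1" for k n
  define a where "a k n = exp (\<mu> n) * ((- \<mu> n) ^ k / fact k) * g k n" for k n
  \<comment> \<open>a bound for \<open>g\<close>: \<open>E n\<close> is at most the first factor and the normalised coefficient at most \<open>exp 2\<close>\<close>
  define K where "K = exp (real (card S) * B) * exp 2 + 1"
  have range_i: "\<forall>\<^sub>F n in sequentially. m i n \<in> {1..b n}"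
    and mean_i: "\<forall>\<^sub>F n in sequentially. \<mu> n \<le> B"
    using insert.prems(1,3) unfolding \<mu>_def by simp_all
  have \<mu>_nonneg: "\<forall>\<^sub>F n in sequentially. 0 \<le> \<mu> n"
    using saddle_pos by eventually_elim (simp add: \<mu>_def mean_count_def)
  have g: "g k \<longlonglongrightarrow> 0" for k
  proof -
    have "\<forall>\<^sub>F n in sequentially. L n + k * m i n \<le> (C + k) * b n"
      using insert.prems(4) range_i
    proof eventually_elim
      case (elim n)
      then have "k * m i n \<le> k * b n" by simp
      then show ?case using elim(1) unfolding add_mult_distrib by linarith
    qed
    then have "(\<lambda>n. E n * norm_coeff (Q n) n (L n + k * m i n)) \<longlonglongrightarrow> 1"
      unfolding E_def Q_def by (intro insert.IH) (use insert.prems in auto)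
    then show ?thesis unfolding g_def using tendsto_diff[OF _ tendsto_const[of 1]] by fastforce
  qed
  have mean_S: "\<forall>\<^sub>F n in sequentially. \<forall>j\<in>S. mean_count n (m j n) \<le> B"
    using insert.hyps(1) insert.prems(3) by (intro eventually_ball_finite) auto
  have g_bound: "\<forall>\<^sub>F n in sequentially. \<forall>k. \<bar>g k n\<bar> \<le> K"
    using norm_coeff_bounds mean_S
  proof eventually_elim
    case (elim n)
    have "(\<Sum>i\<in>S. mean_count n (m i n)) \<le> real (card S) * B"
      using elim(2) sum_bounded_above[of S "\<lambda>i. mean_count n (m i n)" B] by simp
    then have E: "0 \<le> E n" "E n \<le> exp (real (card S) * B)" unfolding E_def by auto
    show ?case
    proof
      fix k
      let ?A = "norm_coeff (Q n) n (L n + k * m i n)"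
      have "Q n \<subseteq> {1..b n}" unfolding Q_def by blast
      then have A: "0 \<le> ?A" "?A \<le> exp 2" using elim(1) by blast+
      have "0 \<le> E n * ?A" "E n * ?A \<le> exp (real (card S) * B) * exp 2"
        using E A by (auto intro!: mult_mono)
      then show "\<bar>g k n\<bar> \<le> K" unfolding g_def K_def by linarith
    qed
  qed
  have a_bound: "\<forall>\<^sub>F n in sequentially. \<forall>k. norm (a k n) \<le> exp B * (B ^ k / fact k) * K"
    using g_bound mean_i \<mu>_nonneg
  proof eventually_elim
    case (elim n)
    show ?case
    proof
      fix k
      have "norm (a k n) = exp (\<mu> n) * (\<mu> n ^ k / fact k) * \<bar>g k n\<bar>"
        using elim(3) by (simp add: a_def abs_mult power_abs)
      also have "\<dots> \<le> exp B * (B ^ k / fact k) * K"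
        using elim by (intro mult_mono divide_right_mono power_mono) auto
      finally show "norm (a k n) \<le> exp B * (B ^ k / fact k) * K" .
    qed
  qed
  have "(\<lambda>n. \<Sum>k. a k n) \<longlonglongrightarrow> (\<Sum>k. 0)"
  proof (rule tannerys_theorem[THEN conjunct2, THEN conjunct2])
    show "(\<lambda>n. a k n) \<longlonglongrightarrow> 0" for k
    proof (rule Lim_null_comparison)
      show "\<forall>\<^sub>F n in sequentially. norm (a k n) \<le> exp B * (B ^ k / fact k) * \<bar>g k n\<bar>"
        using mean_i \<mu>_nonneg
      proof eventually_elim
        case (elim n)
        have "norm (a k n) = exp (\<mu> n) * (\<mu> n ^ k / fact k) * \<bar>g k n\<bar>"
          using elim by (simp add: a_def abs_mult power_abs)
        also have "\<dots> \<le> exp B * (B ^ k / fact k) * \<bar>g k n\<bar>"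
          using elim by (intro mult_mono divide_right_mono power_mono) auto
        finally show ?case .
      qed
      show "(\<lambda>n. exp B * (B ^ k / fact k) * \<bar>g k n\<bar>) \<longlonglongrightarrow> 0"
        by (rule tendsto_mult_right_zero) (rule tendsto_rabs_zero[OF g])
    qed
    show "\<forall>\<^sub>F (k, n) in at_top \<times>\<^sub>F sequentially. norm (a k n) \<le> exp B * (B ^ k / fact k) * K"
      by (rule eventually_mono[OF eventually_prodI[OF eventually_True a_bound]]) auto
    have "summable (\<lambda>k. exp B * K * (B ^ k /\<^sub>R fact k))"
      by (intro summable_mult summable_exp_generic)
    then show "summable (\<lambda>k. exp B * (B ^ k / fact k) * K)"
      by (simp add: divide_inverse_commute mult.assoc mult.left_commute mult.commute)
  qed simp
  then have lim: "(\<lambda>n. (\<Sum>k. a k n) + 1) \<longlonglongrightarrow> 1"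
    using tendsto_add[OF _ tendsto_const[of "1 :: real"]] by fastforce
  have distinct_i: "\<forall>\<^sub>F n in sequentially. \<forall>j\<in>S. m i n \<noteq> m j n"
    using insert.hyps insert.prems(2) by (intro eventually_ball_finite) auto
  have "\<forall>\<^sub>F n in sequentially. (\<Sum>k. a k n) + 1 = exp (\<Sum>j\<in>insert i S. mean_count n (m j n))
            * norm_coeff ({1..b n} - (\<lambda>j. m j n) ` insert i S) n (L n)"
    using saddle_pos range_i distinct_i
  proof eventually_elim
    case (elim n)
    have mem: "0 < m i n" "m i n \<in> Q n" using elim unfolding Q_def by auto
    have Q: "{1..b n} - (\<lambda>j. m j n) ` insert i S = Q n - {m i n}" unfolding Q_def by auto
    let ?T = "norm_coeff (Q n - {m i n}) n (L n)"
    have "(\<lambda>k. (- \<mu> n) ^ k / fact k * norm_coeff (Q n) n (L n + k * m i n)) sums ?T"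
      using norm_coeff_remove[OF elim(1) mem, of "L n"] unfolding \<mu>_def mean_count_def by simp
    then have "(\<lambda>k. exp (\<mu> n) * E n * ((- \<mu> n) ^ k / fact k * norm_coeff (Q n) n (L n + k * m i n)))
        sums (exp (\<mu> n) * E n * ?T)"
      by (rule sums_mult)
    moreover have "(\<lambda>k. exp (\<mu> n) * ((- \<mu> n) ^ k / fact k)) sums (exp (\<mu> n) * exp (- \<mu> n))"
      using exp_converges[of "- \<mu> n"] by (intro sums_mult) (simp add: divide_inverse_commute)
    ultimately have "(\<lambda>k. exp (\<mu> n) * E n * ((- \<mu> n) ^ k / fact k * norm_coeff (Q n) n (L n + k * m i n))
        - exp (\<mu> n) * ((- \<mu> n) ^ k / fact k)) sums (exp (\<mu> n) * E n * ?T - exp (\<mu> n) * exp (- \<mu> n))"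
      by (rule sums_diff)
    then have "(\<lambda>k. a k n) sums (exp (\<mu> n) * E n * ?T - 1)"
      by (simp add: a_def g_def algebra_simps exp_minus_inverse)
    then have "(\<Sum>k. a k n) + 1 = exp (\<mu> n) * E n * ?T" by (simp add: sums_iff)
    also have "exp (\<mu> n) * E n = exp (\<Sum>j\<in>insert i S. mean_count n (m j n))"
      using insert.hyps by (simp add: E_def \<mu>_def exp_add)
    finally show ?case unfolding Q .
  qed
  from lim this show ?case by (rule Lim_transform_eventually)
qed

end

section \<open>The joint law of the cycle counts\<close>

lemma bounded_nats_eq:
  assumes "0 \<le> a"
  shows "{j::nat. 1 \<le> j \<and> real j \<le> a} = {1..nat \<lfloor>a\<rfloor>}"
proof (rule set_eqI)
  fix j :: nat
  have "real j \<le> a \<longleftrightarrow> j \<le> nat \<lfloor>a\<rfloor>"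
    using assms by (metis le_nat_floor of_nat_floor of_nat_le_iff order_trans)
  then show "j \<in> {j. 1 \<le> j \<and> real j \<le> a} \<longleftrightarrow> j \<in> {1..nat \<lfloor>a\<rfloor>}" by simp
qed

lemma cycle_count_eq: "cycle_count n k \<sigma> = cycle_number {1..n} k \<sigma>"
  by (simp add: cycle_count_def cycle_number_def cycles_of_def)

lemma bounded_cycle_perms_eq:
  assumes "0 \<le> \<alpha> n"
  shows "bounded_cycle_perms \<alpha> n
     = {\<sigma>. \<sigma> permutes {1..n} \<and> (\<forall>k. k \<notin> {1..nat \<lfloor>\<alpha> n\<rfloor>} \<longrightarrow> cycle_number {1..n} k \<sigma> = 0)}"
proof -
  have "(\<forall>c\<in>cycles_of n \<sigma>. real (card c) \<le> \<alpha> n)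
      \<longleftrightarrow> (\<forall>k. k \<notin> {1..nat \<lfloor>\<alpha> n\<rfloor>} \<longrightarrow> cycle_number {1..n} k \<sigma> = 0)"
    if \<sigma>: "\<sigma> permutes {1..n}" for \<sigma>
  proof -
    have card_pos: "1 \<le> card c" if c: "c \<in> orbit \<sigma> ` {1..n}" for c
    proof -
      obtain i where i: "i \<in> {1..n}" "c = orbit \<sigma> i" using c by blast
      then have "c \<subseteq> {1..n}" "c \<noteq> {}"
        using permutes_orbit_subset[OF \<sigma> i(1)] orbit_nonempty[of \<sigma> i] by simp_all
      then show ?thesis by (metis One_nat_def Suc_leI card_gt_0_iff finite_atLeastAtMost finite_subset)
    qed
    have zero: "cycle_number {1..n} k \<sigma> = 0 \<longleftrightarrow> (\<forall>c\<in>orbit \<sigma> ` {1..n}. card c \<noteq> k)" for k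
      unfolding cycle_number_def by (subst card_0_eq) auto
    have "real (card c) \<le> \<alpha> n \<longleftrightarrow> card c \<in> {1..nat \<lfloor>\<alpha> n\<rfloor>}" if "c \<in> orbit \<sigma> ` {1..n}" for c
      unfolding bounded_nats_eq[OF assms, symmetric] using card_pos[OF that] by simp
    then show ?thesis unfolding zero cycles_of_def by blast
  qed
  then show ?thesis unfolding bounded_cycle_perms_def by blast
qed

text \<open>
  Cauchy's formula for numerator and denominator. The prescribed counts are indexed by \<open>j\<close> in the
  law and by the length \<open>m j\<close> in \<open>count_perms\<close>; the injectivity of \<open>m\<close> translates between the two.
\<close>

lemma pmf_cycle_count:
  fixes m :: "'k::finite \<Rightarrow> nat"
  assumes \<alpha>: "1 \<le> \<alpha> n" and b: "b = nat \<lfloor>\<alpha> n\<rfloor>" and inj: "inj m" and range: "range m \<subseteq> {1..b}"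
  shows "pmf (cycle_count_pmf \<alpha> n m) l
    = (\<Prod>j\<in>UNIV. 1 / (real (m j) ^ l j * fact (l j)))
      * (if (\<Sum>j\<in>UNIV. m j * l j) \<le> n
         then cycle_egf ({1..b} - range m) $ (n - (\<Sum>j\<in>UNIV. m j * l j)) else 0)
      / bounded_coeff b n"
proof -
  let ?A = "{1..n}" and ?M = "range m" and ?Q = "{1..b} - range m"
  \<comment> \<open>At most one index contributes; writing it as a sum gives the value 0 outside the range of \<open>m\<close>.\<close>
  define l' where "l' k = (\<Sum>j | m j = k. l j)" for k
  have l'_m: "l' (m j) = l j" for j
  proof -
    have "{i. m i = m j} = {j}" using inj by (auto dest: injD)
    then show ?thesis by (simp add: l'_def)
  qed
  have l'_out: "l' k = 0" if "k \<notin> ?M" for k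
  proof -
    have "{i. m i = k} = {}" using that by blast
    then show ?thesis by (simp only: l'_def sum.empty)
  qed
  have B: "bounded_cycle_perms \<alpha> n = {\<sigma>. \<sigma> permutes ?A \<and> (\<forall>k. k \<notin> {1..b} \<longrightarrow> cycle_number ?A k \<sigma> = 0)}"
    unfolding b by (rule bounded_cycle_perms_eq) (use \<alpha> in simp)
  have "real (card (bounded_cycle_perms \<alpha> n)) = real (count_perms ?A {1..b} (\<lambda>_. 0))"
    by (simp only: B count_perms_def)
  also have "\<dots> = fact n * bounded_coeff b n"
    by (subst count_perms_eq[where M = "{}"]) (simp_all add: cauchy_coeff_def bounded_coeff_def)
  finally have total: "real (card (bounded_cycle_perms \<alpha> n)) = fact n * bounded_coeff b n" .
  have "{\<sigma> \<in> bounded_cycle_perms \<alpha> n. (\<lambda>j. cycle_count n (m j) \<sigma>) = l}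
      = {\<sigma>. \<sigma> permutes ?A \<and> (\<forall>k. k \<notin> ?Q \<longrightarrow> cycle_number ?A k \<sigma> = l' k)}"
  proof -
    have "(\<forall>k. k \<notin> {1..b} \<longrightarrow> c k = 0) \<and> (\<lambda>j. c (m j)) = l \<longleftrightarrow> (\<forall>k. k \<notin> ?Q \<longrightarrow> c k = l' k)"
      for c :: "nat \<Rightarrow> nat"
    proof (intro iffI allI impI conjI)
      fix k assume c: "(\<forall>k. k \<notin> {1..b} \<longrightarrow> c k = 0) \<and> (\<lambda>j. c (m j)) = l" and k: "k \<notin> ?Q"
      show "c k = l' k"
      proof (cases "k \<in> ?M")
        case True
        then show ?thesis using l'_m c by auto
      next
        case False
        then show ?thesis using c k l'_out[of k] by simp
      qed
    next
      fix k assume c: "\<forall>k. k \<notin> ?Q \<longrightarrow> c k = l' k" and k: "k \<notin> {1..b}"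
      then have "k \<notin> ?M" "k \<notin> ?Q" using range by blast+
      moreover have "c k = l' k" using c \<open>k \<notin> ?Q\<close> by blast
      ultimately show "c k = 0" using l'_out[of k] by simp
    next
      assume c: "\<forall>k. k \<notin> ?Q \<longrightarrow> c k = l' k"
      then show "(\<lambda>j. c (m j)) = l" using l'_m by auto
    qed
    from this[of "\<lambda>k. cycle_number ?A k \<sigma>" for \<sigma>] show ?thesis
      unfolding B cycle_count_eq by blast
  qed
  then have "real (card {\<sigma> \<in> bounded_cycle_perms \<alpha> n. (\<lambda>j. cycle_count n (m j) \<sigma>) = l})
      = real (count_perms ?A ?Q l')"
    by (simp only: count_perms_def)
  also have "\<dots> = fact (card ?A) * (cauchy_coeff ?M l' *
        (if (\<Sum>k\<in>?M. k * l' k) \<le> card ?A then cycle_egf ?Q $ (card ?A - (\<Sum>k\<in>?M. k * l' k)) else 0))"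
    by (rule count_perms_eq) (use l'_out range in auto)
  also have "(\<Sum>k\<in>?M. k * l' k) = (\<Sum>j\<in>UNIV. m j * l j)"
    by (simp add: sum.reindex[OF inj] l'_m)
  also have "cauchy_coeff ?M l' = (\<Prod>j\<in>UNIV. 1 / (real (m j) ^ l j * fact (l j)))"
    by (simp add: cauchy_coeff_def prod.reindex[OF inj] l'_m)
  finally have joint: "real (card {\<sigma> \<in> bounded_cycle_perms \<alpha> n. (\<lambda>j. cycle_count n (m j) \<sigma>) = l})
    = fact n * ((\<Prod>j\<in>UNIV. 1 / (real (m j) ^ l j * fact (l j)))
      * (if (\<Sum>j\<in>UNIV. m j * l j) \<le> n
         then cycle_egf ?Q $ (n - (\<Sum>j\<in>UNIV. m j * l j)) else 0))"
    by simp
  have "pmf (cycle_count_pmf \<alpha> n m) l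
      = real (card {\<sigma> \<in> bounded_cycle_perms \<alpha> n. (\<lambda>j. cycle_count n (m j) \<sigma>) = l})
        / real (card (bounded_cycle_perms \<alpha> n))"
    unfolding cycle_count_pmf_def uniform_perm_def pmf_map
    by (subst measure_pmf_of_set[OF bounded_cycle_perms_nonempty[of \<alpha> n, OF \<alpha>] finite_bounded_cycle_perms])
       (simp add: Int_def)
  then show ?thesis unfolding total joint by simp
qed

section \<open>Limits of reweighted distributions\<close>

lemma integral_pmf_tilt:
  fixes f :: "'a \<Rightarrow> real"
  assumes "\<And>l. pmf q l = c * (pmf p l * \<phi> l)"
  shows "(\<integral>l. f l \<partial>measure_pmf q) = c * (\<integral>l. f l * \<phi> l \<partial>measure_pmf p)"
proof -
  have "(\<integral>l. f l \<partial>measure_pmf q) = (\<integral>l. pmf q l *\<^sub>R f l \<partial>count_space UNIV)"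
    unfolding measure_pmf_eq_density[of q] by (rule integral_density) auto
  also have "\<dots> = (\<integral>l. c * (pmf p l *\<^sub>R (f l * \<phi> l)) \<partial>count_space UNIV)"
    by (rule Bochner_Integration.integral_cong) (simp_all add: assms)
  also have "\<dots> = c * (\<integral>l. pmf p l *\<^sub>R (f l * \<phi> l) \<partial>count_space UNIV)"
    by (rule integral_mult_right_zero)
  also have "(\<integral>l. pmf p l *\<^sub>R (f l * \<phi> l) \<partial>count_space UNIV) = (\<integral>l. f l * \<phi> l \<partial>measure_pmf p)"
    unfolding measure_pmf_eq_density[of p] by (rule integral_density[symmetric]) auto
  finally show ?thesis .
qed

text \<open>
  The constant \<open>c\<close> is determined by the total mass 1 of \<open>q\<close>.
\<close>

lemma integral_pmf_normalized:
  fixes f :: "'a \<Rightarrow> real"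
  assumes "\<And>l. pmf q l = c * (pmf p l * \<phi> l)"
  shows "(\<integral>l. f l \<partial>measure_pmf q)
           = (\<integral>l. f l * \<phi> l \<partial>measure_pmf p) / (\<integral>l. \<phi> l \<partial>measure_pmf p)"
proof -
  have "1 = c * (\<integral>l. \<phi> l \<partial>measure_pmf p)"
    using integral_pmf_tilt[OF assms, where f = "\<lambda>_. 1"] by simp
  then have "c = 1 / (\<integral>l. \<phi> l \<partial>measure_pmf p)"
    by (metis mult_zero_right nonzero_eq_divide_eq zero_neq_one)
  then show ?thesis using integral_pmf_tilt[OF assms, where f = f] by simp
qed

text \<open>
  In the quotient given by \<open>integral_pmf_normalized\<close>, numerator and denominator converge separately, by
  dominated convergence.
\<close>

lemma integral_tilt_tendsto:
  fixes f :: "'a \<Rightarrow> real" and q :: "nat \<Rightarrow> 'a pmf"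
  assumes q: "\<forall>\<^sub>F n in sequentially. \<exists>c. \<forall>l. pmf (q n) l = c * (pmf p l * \<phi> n l)"
    and bound: "\<forall>\<^sub>F n in sequentially. \<forall>l. \<bar>\<phi> n l\<bar> \<le> K"
    and lim: "\<And>l. (\<lambda>n. \<phi> n l) \<longlonglongrightarrow> 1"
    and f: "bounded (range f)"
  shows "(\<lambda>n. \<integral>l. f l \<partial>measure_pmf (q n)) \<longlonglongrightarrow> (\<integral>l. f l \<partial>measure_pmf p)"
proof -
  \<comment> \<open>The bound is only eventual, but dominated convergence asks for it at every \<open>n\<close>.\<close>
  define \<psi> where "\<psi> n l = (if \<forall>l. \<bar>\<phi> n l\<bar> \<le> K then \<phi> n l else 0)" for n l
  have \<psi>_eq: "\<forall>\<^sub>F n in sequentially. \<psi> n = \<phi> n"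
    using bound by eventually_elim (simp add: \<psi>_def fun_eq_iff)
  have \<psi>: "(\<lambda>n. \<psi> n l) \<longlonglongrightarrow> 1" for l
    by (rule Lim_transform_eventually[OF lim[of l]])
       (use \<psi>_eq in eventually_elim, simp)
  have \<psi>_bound: "\<bar>\<psi> n l\<bar> \<le> \<bar>K\<bar>" for n l
    using abs_ge_self[of K] by (auto simp: \<psi>_def intro: order_trans)
  have main: "(\<lambda>n. \<integral>l. g l * \<psi> n l \<partial>measure_pmf p) \<longlonglongrightarrow> (\<integral>l. g l \<partial>measure_pmf p)"
    if "bounded (range g)" for g :: "'a \<Rightarrow> real"
  proof -
    obtain G where G: "\<And>l. \<bar>g l\<bar> \<le> G" using \<open>bounded (range g)\<close> by (auto simp: bounded_iff)
    show ?thesis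
    proof (rule integral_dominated_convergence[where w = "\<lambda>_. G * \<bar>K\<bar>"])
      show "AE l in measure_pmf p. (\<lambda>n. g l * \<psi> n l) \<longlonglongrightarrow> g l"
        using tendsto_mult[OF tendsto_const \<psi>] by (intro always_eventually allI) fastforce
      show "AE l in measure_pmf p. norm (g l * \<psi> n l) \<le> G * \<bar>K\<bar>" for n
        by (intro always_eventually allI)
           (auto simp: abs_mult intro!: mult_mono G \<psi>_bound order_trans[OF abs_ge_zero G])
    qed auto
  qed
  have "(\<lambda>n. (\<integral>l. f l * \<psi> n l \<partial>measure_pmf p) / (\<integral>l. \<psi> n l \<partial>measure_pmf p))
      \<longlonglongrightarrow> (\<integral>l. f l \<partial>measure_pmf p) / 1"
    by (intro tendsto_divide main f) (use main[of "\<lambda>_. 1"] in simp_all)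
  moreover have "\<forall>\<^sub>F n in sequentially. (\<integral>l. f l * \<psi> n l \<partial>measure_pmf p) / (\<integral>l. \<psi> n l \<partial>measure_pmf p)
      = (\<integral>l. f l \<partial>measure_pmf (q n))"
    using q \<psi>_eq
  proof eventually_elim
    case (elim n)
    then obtain c where "\<And>l. pmf (q n) l = c * (pmf p l * \<phi> n l)" by blast
    then show ?case using integral_pmf_normalized[of "q n" c p "\<phi> n" f] elim(2) by simp
  qed
  ultimately show ?thesis by (simp add: Lim_transform_eventually)
qed

lemma pmf_indep_poisson_one:
  "pmf (indep_poisson_one :: ('k::finite \<Rightarrow> nat) pmf) l
     = exp (- real (CARD('k))) * (\<Prod>j\<in>UNIV. 1 / fact (l j))"
proof -
  have "pmf (indep_poisson_one :: ('k \<Rightarrow> nat) pmf) l = (\<Prod>j\<in>UNIV. exp (- 1) * (1 / fact (l j)))"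
    unfolding indep_poisson_one_def by (subst pmf_Pi) simp_all
  also have "\<dots> = exp (- 1) ^ CARD('k) * (\<Prod>j\<in>UNIV. 1 / fact (l j))"
    by (simp only: prod.distrib prod_constant)
  also have "exp (- 1 :: real) ^ CARD('k) = exp (- real (CARD('k)))"
    by (simp flip: exp_of_nat_mult)
  finally show ?thesis .
qed

section \<open>Convergence of the tilted cycle counts\<close>

context saddle_sequence begin

text \<open>
  The powers of \<open>m j\<close> in Cauchy's formula cancel against those in \<open>mean_count n (m j) ^ l j\<close>, leaving
  the power of the saddle point that normalises the coefficient.
\<close>

lemma tilt_weight_eq:
  fixes m :: "'k::finite \<Rightarrow> nat"
  assumes \<alpha>: "1 \<le> \<alpha> n" and b: "b n = nat \<lfloor>\<alpha> n\<rfloor>" and inj: "inj m" and range: "range m \<subseteq> {1..b n}"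
    and x: "0 < x n"
  shows "tilt_weight (\<lambda>j. mean_count n (m j)) (cycle_count_pmf \<alpha> n m) l
    = exp (real (CARD('k))) * (pmf indep_poisson_one l
      * (exp (\<Sum>j\<in>UNIV. mean_count n (m j)) * norm_coeff ({1..b n} - range m) n (\<Sum>j\<in>UNIV. m j * l j)))"
proof -
  let ?L = "\<Sum>j\<in>UNIV. m j * l j" and ?\<mu> = "\<lambda>j. mean_count n (m j)"
  let ?c = "if ?L \<le> n then cycle_egf ({1..b n} - range m) $ (n - ?L) else 0"
  have m0: "0 < m j" for j using subsetD[OF range rangeI, of j] by simp
  have "(\<Prod>j\<in>UNIV. exp (?\<mu> j) / ?\<mu> j ^ l j) * (\<Prod>j\<in>UNIV. 1 / (real (m j) ^ l j * fact (l j)))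
      = (\<Prod>j\<in>UNIV. exp (?\<mu> j) * (1 / fact (l j)) * (1 / x n ^ (m j * l j)))"
    unfolding prod.distrib[symmetric]
  proof (rule prod.cong[OF refl])
    fix j
    show "exp (?\<mu> j) / ?\<mu> j ^ l j * (1 / (real (m j) ^ l j * fact (l j)))
        = exp (?\<mu> j) * (1 / fact (l j)) * (1 / x n ^ (m j * l j))"
      using m0[of j] x by (simp add: mean_count_def power_divide power_mult)
  qed
  also have "\<dots> = exp (\<Sum>j\<in>UNIV. ?\<mu> j) * (\<Prod>j\<in>UNIV. 1 / fact (l j)) * (1 / x n ^ ?L)"
    by (simp add: prod.distrib exp_sum power_sum prod_dividef)
  finally have prod_eq: "(\<Prod>j\<in>UNIV. exp (?\<mu> j) / ?\<mu> j ^ l j) * (\<Prod>j\<in>UNIV. 1 / (real (m j) ^ l j * fact (l j)))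
      = exp (\<Sum>j\<in>UNIV. ?\<mu> j) * (\<Prod>j\<in>UNIV. 1 / fact (l j)) * (1 / x n ^ ?L)" .
  have "tilt_weight ?\<mu> (cycle_count_pmf \<alpha> n m) l
      = ((\<Prod>j\<in>UNIV. exp (?\<mu> j) / ?\<mu> j ^ l j) * (\<Prod>j\<in>UNIV. 1 / (real (m j) ^ l j * fact (l j))))
        * (?c / bounded_coeff (b n) n)"
    unfolding tilt_weight_def pmf_cycle_count[where \<alpha> = \<alpha> and n = n, OF \<alpha> b inj range] by simp
  also have "\<dots> = (\<Prod>j\<in>UNIV. 1 / fact (l j)) * (exp (\<Sum>j\<in>UNIV. ?\<mu> j) * norm_coeff ({1..b n} - range m) n ?L)"
    unfolding prod_eq norm_coeff_def by (simp add: mult_ac)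
  also have "(\<Prod>j\<in>UNIV. 1 / fact (l j)) = exp (real (CARD('k))) * pmf indep_poisson_one l"
    unfolding pmf_indep_poisson_one by (simp add: exp_minus)
  finally show ?thesis by (simp only: mult.assoc)
qed

end

lemma limsup_less_infinity_imp_bounded:
  fixes f :: "nat \<Rightarrow> real"
  assumes "limsup (\<lambda>n. ereal (f n)) < \<infinity>"
  obtains B where "\<forall>\<^sub>F n in sequentially. f n \<le> B"
proof -
  obtain N :: nat where "limsup (\<lambda>n. ereal (f n)) < ereal (real N)"
    using assms less_PInf_Ex_of_nat by auto
  then have "\<forall>\<^sub>F n in sequentially. ereal (f n) < ereal (real N)" by (rule Limsup_lessD)
  then show ?thesis by (intro that[of "real N"]) (auto elim: eventually_mono)
qed

lemma saddle_sequence_saddle_point: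
  fixes \<alpha> :: "nat \<Rightarrow> real"
  assumes "0 < a\<^sub>1" "a\<^sub>2 < 1"
    and \<alpha>: "\<And>n. 1 \<le> n \<Longrightarrow> real n powr a\<^sub>1 \<le> \<alpha> n \<and> \<alpha> n \<le> real n powr a\<^sub>2"
  shows "saddle_sequence (\<lambda>n. nat \<lfloor>\<alpha> n\<rfloor>) (saddle_point \<alpha>)"
proof
  have \<alpha>1: "1 \<le> \<alpha> n" if "1 \<le> n" for n
    using \<alpha>[OF that] that assms(1) ge_one_powr_ge_zero[of "real n" a\<^sub>1] by simp
  have saddle: "0 < saddle_point \<alpha> n \<and> real n = (\<Sum>j=1..nat \<lfloor>\<alpha> n\<rfloor>. saddle_point \<alpha> n ^ j)"
    if "1 \<le> n" for n
    using theI'[OF saddle_point_ex1[of n \<alpha>, OF that \<alpha>1[OF that]]] \<alpha>1[OF that]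
      bounded_nats_eq[of "\<alpha> n"]
    unfolding saddle_point_def by simp
  show "\<forall>\<^sub>F n in sequentially. 1 \<le> nat \<lfloor>\<alpha> n\<rfloor>"
    using eventually_ge_at_top[of 1]
  proof eventually_elim
    case (elim n)
    then show ?case using \<alpha>1[of n] by (simp add: le_nat_iff le_floor_iff)
  qed
  show "\<forall>\<^sub>F n in sequentially. 0 < saddle_point \<alpha> n"
    using eventually_ge_at_top[of 1] by eventually_elim (rule saddle[THEN conjunct1])
  show "\<forall>\<^sub>F n in sequentially. (\<Sum>j=1..nat \<lfloor>\<alpha> n\<rfloor>. saddle_point \<alpha> n ^ j) = real n"
    using eventually_ge_at_top[of 1] by eventually_elim (rule saddle[THEN conjunct2, symmetric])
  show "(\<lambda>n. real (nat \<lfloor>\<alpha> n\<rfloor>) / real n) \<longlonglongrightarrow> 0"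
  proof (rule Lim_null_comparison)
    show "\<forall>\<^sub>F n in sequentially. norm (real (nat \<lfloor>\<alpha> n\<rfloor>) / real n) \<le> real n powr (a\<^sub>2 - 1)"
      using eventually_ge_at_top[of 1]
    proof eventually_elim
      case (elim n)
      have "real (nat \<lfloor>\<alpha> n\<rfloor>) \<le> \<alpha> n" using \<alpha>1[OF elim] by (intro of_nat_floor) simp
      also have "\<dots> \<le> real n powr a\<^sub>2" using \<alpha>[OF elim] by blast
      finally have "real (nat \<lfloor>\<alpha> n\<rfloor>) / real n \<le> real n powr a\<^sub>2 / real n" by (intro divide_right_mono) auto
      also have "\<dots> = real n powr (a\<^sub>2 - 1)" using elim by (simp add: powr_diff)
      finally show ?case by simp
    qed
    show "(\<lambda>n. real n powr (a\<^sub>2 - 1)) \<longlonglongrightarrow> 0"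
      by (rule tendsto_neg_powr[OF _ filterlim_real_sequentially]) (use assms(2) in simp)
  qed
qed

unbundle no fps_syntax
unbundle vec_syntax

theorem theorem2p3:
  fixes a\<^sub>1 a\<^sub>2 :: real
    and \<alpha> :: "nat \<Rightarrow> real"
    and m :: "'k::finite \<Rightarrow> nat \<Rightarrow> nat"
  assumes "0 < a\<^sub>1" "a\<^sub>1 < 1" "0 < a\<^sub>2" "a\<^sub>2 < 1"
    and "\<And>n. 1 \<le> n \<Longrightarrow> real n powr a\<^sub>1 \<le> \<alpha> n \<and> \<alpha> n \<le> real n powr a\<^sub>2"
    and "\<And>j n. 1 \<le> n \<Longrightarrow> 1 \<le> m j n \<and> real (m j n) \<le> \<alpha> n"
    and "\<And>i j. i \<noteq> j \<Longrightarrow> eventually (\<lambda>n. m i n \<noteq> m j n) sequentially"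
    and "\<And>j. limsup (\<lambda>n. ereal (cycle_mean \<alpha> n (m j n))) < \<infinity>"
  shows "conv_in_distribution
           (\<lambda>n. vector_law (tilted_cycle_count_pmf \<alpha> n
                  (\<lambda>j. cycle_mean \<alpha> n (m j n)) (\<lambda>j. m j n)))
           (vector_law (indep_poisson_one :: ('k \<Rightarrow> nat) pmf))"
proof -
  define b where "b n = nat \<lfloor>\<alpha> n\<rfloor>" for n
  interpret saddle_sequence b "saddle_point \<alpha>"
    unfolding b_def by (rule saddle_sequence_saddle_point[OF assms(1,4,5)])
  have mean_eq: "cycle_mean \<alpha> n k = mean_count n k" for n k
    by (simp add: cycle_mean_def mean_count_def)
  have \<alpha>1: "\<forall>\<^sub>F n in sequentially. 1 \<le> \<alpha> n"
    using eventually_ge_at_top[of 1]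
  proof eventually_elim
    case (elim n)
    have "1 \<le> real n powr a\<^sub>1" using elim assms(1) by (intro ge_one_powr_ge_zero) auto
    then show ?case using assms(5)[OF elim] by linarith
  qed
  have range_m: "\<forall>\<^sub>F n in sequentially. m j n \<in> {1..b n}" for j
    using eventually_ge_at_top[of 1] \<alpha>1
  proof eventually_elim
    case (elim n)
    then show ?case
      using assms(6)[OF elim(1), of j] bounded_nats_eq[of "\<alpha> n"] unfolding b_def by auto
  qed
  have ranges: "\<forall>\<^sub>F n in sequentially. range (\<lambda>j. m j n) \<subseteq> {1..b n}"
  proof -
    have "\<forall>\<^sub>F n in sequentially. \<forall>j. m j n \<in> {1..b n}"
      by (rule eventually_all_finite) (rule range_m)
    then show ?thesis by eventually_elim blast
  qed
  have inj: "\<forall>\<^sub>F n in sequentially. inj (\<lambda>j. m j n)"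
  proof -
    have "\<forall>\<^sub>F n in sequentially. \<forall>i j. i \<noteq> j \<longrightarrow> m i n \<noteq> m j n"
      using assms(7) by (intro eventually_all_finite) (auto intro: eventually_mono)
    then show ?thesis by eventually_elim (auto simp: inj_def)
  qed
  obtain B where B: "\<And>j. \<forall>\<^sub>F n in sequentially. mean_count n (m j n) \<le> B"
  proof -
    have "\<exists>B. \<forall>\<^sub>F n in sequentially. mean_count n (m j n) \<le> B" for j
      using limsup_less_infinity_imp_bounded[OF assms(8)[of j]] unfolding mean_eq by blast
    then obtain B where B: "\<And>j. \<forall>\<^sub>F n in sequentially. mean_count n (m j n) \<le> B j" by metis
    show ?thesis
    proof (rule that[of "Max (range B)"])
      fix j
      show "\<forall>\<^sub>F n in sequentially. mean_count n (m j n) \<le> Max (range B)"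
        using B[of j] by eventually_elim (rule order_trans[OF _ Max_ge], auto)
    qed
  qed
  define \<phi> where "\<phi> n l = exp (\<Sum>j\<in>UNIV. mean_count n (m j n))
      * norm_coeff ({1..b n} - range (\<lambda>j. m j n)) n (\<Sum>j\<in>UNIV. m j n * l j)" for n l
  have \<phi>_lim: "(\<lambda>n. \<phi> n l) \<longlonglongrightarrow> 1" for l
    unfolding \<phi>_def
  proof (rule norm_coeff_remove_tendsto)
    show "\<forall>\<^sub>F n in sequentially. (\<Sum>j\<in>UNIV. m j n * l j) \<le> (\<Sum>j\<in>UNIV. l j) * b n"
      using ranges
    proof eventually_elim
      case (elim n)
      have "(\<Sum>j\<in>UNIV. m j n * l j) \<le> (\<Sum>j\<in>UNIV. l j * b n)"
      proof (rule sum_mono)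
        fix j
        have "m j n \<le> b n" using subsetD[OF elim rangeI, of j] by simp
        then show "m j n * l j \<le> l j * b n" by (simp add: mult.commute)
      qed
      then show ?case by (simp add: sum_distrib_right)
    qed
  qed (use range_m B assms(7) in auto)
  have \<phi>_bound: "\<forall>\<^sub>F n in sequentially. \<forall>l. \<bar>\<phi> n l\<bar> \<le> exp (real (CARD('k)) * B) * exp 2"
  proof -
    have "\<forall>\<^sub>F n in sequentially. \<forall>j. mean_count n (m j n) \<le> B"
      by (rule eventually_all_finite) (rule B)
    then show ?thesis using norm_coeff_bounds
    proof eventually_elim
      case (elim n)
      have "(\<Sum>j\<in>UNIV. mean_count n (m j n)) \<le> real (CARD('k)) * B"
        using elim(1) sum_bounded_above[of UNIV "\<lambda>j. mean_count n (m j n)" B] by simp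
      then show ?case
        using elim(2) unfolding \<phi>_def
        by (auto simp: abs_mult intro!: mult_mono)
    qed
  qed
  have tilt: "\<forall>\<^sub>F n in sequentially. \<exists>c. \<forall>l.
      pmf (tilted_cycle_count_pmf \<alpha> n (\<lambda>j. cycle_mean \<alpha> n (m j n)) (\<lambda>j. m j n)) l
        = c * (pmf indep_poisson_one l * \<phi> n l)"
    using \<alpha>1 inj ranges saddle_pos
  proof eventually_elim
    case (elim n)
    let ?p = "cycle_count_pmf \<alpha> n (\<lambda>j. m j n)" and ?\<nu> = "\<lambda>j. mean_count n (m j n)"
    define Z where "Z = (\<Sum>\<^sub>\<infinity>l. tilt_weight ?\<nu> ?p l)"
    have \<nu>: "0 < ?\<nu> j" for j
    proof -
      have "m j n \<in> {1..b n}" using elim(3) by blast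
      then show ?thesis using elim(4) by (simp add: mean_count_def)
    qed
    have "pmf (tilt_pmf ?\<nu> ?p) l = exp (real (CARD('k))) / Z * (pmf indep_poisson_one l * \<phi> n l)" for l
      unfolding pmf_tilt_pmf[OF \<nu> finite_set_cycle_count_pmf[of \<alpha> n, OF elim(1)]] Z_def[symmetric]
        tilt_weight_eq[where \<alpha> = \<alpha> and n = n, OF elim(1) b_def elim(2-4)] \<phi>_def by simp
    then show ?case unfolding tilted_cycle_count_pmf_def mean_eq by blast
  qed
  have law: "(\<integral>v. f v \<partial>vector_law p) = (\<integral>l. f (\<chi> j. real (l j)) \<partial>measure_pmf p)"
    if "continuous_on UNIV f" for f :: "real ^ 'k \<Rightarrow> real" and p
    unfolding vector_law_def
    by (rule integral_distr) (use that in \<open>auto intro: borel_measurable_continuous_onI\<close>)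
  show ?thesis
    unfolding conv_in_distribution_def
  proof (intro allI impI)
    fix f :: "real ^ 'k \<Rightarrow> real"
    assume f: "continuous_on UNIV f" "bounded (range f)"
    have "bounded (range (\<lambda>l :: 'k \<Rightarrow> nat. f (\<chi> j. real (l j))))"
      by (rule bounded_subset[OF f(2)]) auto
    then show "(\<lambda>n. \<integral>v. f v \<partial>vector_law (tilted_cycle_count_pmf \<alpha> n
          (\<lambda>j. cycle_mean \<alpha> n (m j n)) (\<lambda>j. m j n)))
        \<longlonglongrightarrow> (\<integral>v. f v \<partial>vector_law (indep_poisson_one :: ('k \<Rightarrow> nat) pmf))"
      unfolding law[OF f(1)] by (rule integral_tilt_tendsto[OF tilt \<phi>_bound \<phi>_lim])
  qed
qed

end
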